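(* The pairwise distinct block idempotents of $\mathbb{T}$ are exactly the matrices $D_1, D_2,\ldots,D_{2^{n_-}}$, and $|\mathrm{Bl}(\mathbb{T})|=2^{n_-}$. In particular, the decomposition of $\mathbb{T}$ into the direct sum of all its pairwise distinct block algebras is $$\mathbb{T}=\bigoplus_{g=1}^{2^{n_-}}\mathbb{T}D_g.$$
   Context: Setting. Let $\mathbb{F}$ be a field of characteristic $p$ (possibly $p=0$; $0\mid m$ iff $m=0$). For an integer $m$, $\overline{m}$ is its image in $\mathbb{F}$. Let $n\ge 1$, let $\mathbb{U}_1,\ldots,\mathbb{U}_n$ be finite sets with $|\mathbb{U}_a|\ge 2$, let $\mathbb{X}=\prod_{a=1}^n\mathbb{U}_a$, and fix $\mathbf{x}\in\mathbb{X}$. Let $\mathbb{E}$ be the set of all subsets of $[n]=\{1,\ldots,n\}$ (the paper uses tuples in $\{0,1\}^n$; here a tuple is identified with its support). For $h\in\mathbb{E}$ let $R_h=\{(y,z)\in\mathbb{X}\times\mathbb{X}: y_a\neq z_a \text{ iff } a\in h\}$; $(\mathbb{X},\{R_h\}_{h\in\mathbb{E}})$ is the factorial association scheme. In the full matrix algebra $\mathrm{M}_\mathbb{X}(\mathbb{F})$, $A_h$ is the adjacency matrix of $R_h$, and $E_h^*$ is the diagonal matrix whose $(y,y)$-entry is $1$ if $(\mathbf{x},y)\in R_h$ and $0$ otherwise. The Terwilliger $\mathbb{F}$-algebra $\mathbb{T}$ is the $\mathbb{F}$-subalgebra of $\mathrm{M}_\mathbb{X}(\mathbb{F})$ generated by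 all $A_h$ and $E_h^*$, $h\in\mathbb{E}$. Notation. $k_h=\prod_{a\in h}(|\mathbb{U}_a|-1)$ (with $k_\varnothing=1$). For $V\subseteq[n]$: $V^\circ=\{a\in V: |\mathbb{U}_a|\neq 2\}$, $V^+=\{a\in V: p\mid |\mathbb{U}_a|-1\}$, $V^-=\{a\in V: |\mathbb{U}_a|\ne 2,\ p\nmid|\mathbb{U}_a|-1\}$; $n_\pm=|[n]^\pm|$. $\triangle$ is symmetric difference. $\mathbb{P}=\{(a,b,c)\in\mathbb{E}^3: a\triangle c\subseteq b\subseteq (a\triangle c)\cup(a\cap c)^\circ\}$, and for $(a,b,c)\in\mathbb{P}$, $B_{a,b,c}=\sum_{a\triangle c\subseteq j\subseteq b}E_a^*A_jE_c^*$. For $(a,b,c)\in\mathbb{P}$ with $p\nmid k_b$, $$D_{a,b,c}=\sum_{q}(\overline{-1})^{|q\setminus b|}\,\overline{k_{c\cap q}}^{\,-1}B_{a,q,c},$$ the sum over all $q\in\mathbb{E}$ with $b\subseteq q\subseteq (a\triangle c)\cup(a\cap c)^\circ$ and $p\nmid k_q$. On $\{(a,b,a)\in\mathbb{P}: p\nmid k_b\}$ put $(a,b,a)\approx(a',b',a')$ iff $a^-\setminus b=a'^-\setminus b'$. This is an equivalence relation with exactly $2^{n_-}$ classes; enumerate them as $\mathbb{C}_1,\ldots,\mathbb{C}_{2^{n_-}}$. For $m\in\{1,\ldots,2^{n_-}\}$ let $D_m=\sum_{(a,b,a)\in\mathbb{C}_m}D_{a,b,a}$. Blocks. $\mathrm{Z}(\mathbb{A})$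 denotes the center of an $\mathbb{F}$-algebra $\mathbb{A}$. A block idempotent of $\mathbb{A}$ is a primitive idempotent of $\mathrm{Z}(\mathbb{A})$ (a nonzero idempotent that is not a sum of two or more pairwise orthogonal nonzero idempotents). $\mathrm{Bl}(\mathbb{A})$ is the set of block idempotents; for $e\in\mathrm{Bl}(\mathbb{A})$ the algebra $\mathbb{A}e$ (with identity $e$) is called a block algebra of $\mathbb{A}$. *)

theory Defs
  imports
    "HOL-Library.Function_Algebras"
    "HOL-Library.FuncSet"
    "HOL-Computational_Algebra.Computational_Algebra"
begin

section \<open>Matrices with rows and columns indexed by a finite set\<close>

text \<open>
  A matrix in $M_X(F)$ is a function of two arguments that vanishes outside $X \times X$.
  Zero and sums of matrices are the pointwise ones of \<^theory>\<open>HOL-Library.Function_Algebras\<close>.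
  The instance of \<open>*\<close> on functions provided there is the entrywise product, which is not
  used; the matrix product is \<open>mat_mult X\<close>.
\<close>

type_synonym ('i, 'f) matrix = "'i \<Rightarrow> 'i \<Rightarrow> 'f"

definition mat_carrier :: "'i set \<Rightarrow> ('i, 'f::field) matrix set" where
  "mat_carrier X = {M. \<forall>y z. M y z \<noteq> 0 \<longrightarrow> y \<in> X \<and> z \<in> X}"

definition mat_mult :: "'i set \<Rightarrow> ('i, 'f::field) matrix \<Rightarrow> ('i, 'f) matrix \<Rightarrow> ('i, 'f) matrix" where
  "mat_mult X M N = (\<lambda>y z. \<Sum>w\<in>X. M y w * N w z)"

definition mat_one :: "'i set \<Rightarrow> ('i, 'f::field) matrix" where
  "mat_one X = (\<lambda>y z. if y \<in> X \<and> y = z then 1 else 0)"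

definition mat_scale :: "'f::field \<Rightarrow> ('i, 'f) matrix \<Rightarrow> ('i, 'f) matrix" where
  "mat_scale c M = (\<lambda>y z. c * M y z)"

global_interpretation mat: vector_space mat_scale
  by standard (simp_all add: mat_scale_def fun_eq_iff algebra_simps)


section \<open>Subalgebras, block idempotents and block algebras\<close>

text \<open>
  Throughout, \<open>A\<close> is (the underlying set of) a unital subalgebra of $M_X(F)$.
\<close>

definition mat_subalgebra :: "'i set \<Rightarrow> ('i, 'f::field) matrix set \<Rightarrow> bool" where
  "mat_subalgebra X A \<longleftrightarrow>
     A \<subseteq> mat_carrier X \<and> mat.subspace A \<and> mat_one X \<in> A \<and>
     (\<forall>M\<in>A. \<forall>N\<in>A. mat_mult X M N \<in> A)"

definition alg_center :: "'i set \<Rightarrow> ('i, 'f::field) matrix set \<Rightarrow> ('i, 'f) matrix set" where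
  "alg_center X A = {Z \<in> A. \<forall>M\<in>A. mat_mult X Z M = mat_mult X M Z}"

definition nonzero_idempotent :: "'i set \<Rightarrow> ('i, 'f::field) matrix \<Rightarrow> bool" where
  "nonzero_idempotent X e \<longleftrightarrow> e \<noteq> 0 \<and> mat_mult X e e = e"

text \<open>
  Pairwise orthogonal nonzero idempotents are automatically distinct, so a family of two or more
  of them is the same thing as a finite set \<open>S\<close> with at least two elements.
\<close>

definition primitive_idempotent ::
  "'i set \<Rightarrow> ('i, 'f::field) matrix set \<Rightarrow> ('i, 'f) matrix \<Rightarrow> bool" where
  "primitive_idempotent X A e \<longleftrightarrow>
     e \<in> A \<and> nonzero_idempotent X e \<and>
     \<not> (\<exists>S. finite S \<and> card S \<ge> 2 \<and> S \<subseteq> A \<and>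
            (\<forall>f\<in>S. nonzero_idempotent X f) \<and>
            (\<forall>f\<in>S. \<forall>g\<in>S. f \<noteq> g \<longrightarrow> mat_mult X f g = 0) \<and>
            e = (\<Sum>f\<in>S. f))"

definition Bl :: "'i set \<Rightarrow> ('i, 'f::field) matrix set \<Rightarrow> ('i, 'f) matrix set" where
  "Bl X A = {e. primitive_idempotent X (alg_center X A) e}"

definition block_algebra ::
  "'i set \<Rightarrow> ('i, 'f::field) matrix set \<Rightarrow> ('i, 'f) matrix \<Rightarrow> ('i, 'f) matrix set" where
  "block_algebra X A e = {mat_mult X M e |M. M \<in> A}"

definition two_sided_ideal ::
  "'i set \<Rightarrow> ('i, 'f::field) matrix set \<Rightarrow> ('i, 'f) matrix set \<Rightarrow> bool" where
  "two_sided_ideal X A I \<longleftrightarrow>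
     I \<subseteq> A \<and> mat.subspace I \<and>
     (\<forall>M\<in>A. \<forall>N\<in>I. mat_mult X M N \<in> I \<and> mat_mult X N M \<in> I)"

text \<open>
  Internal direct sum of algebras: every summand is a two-sided ideal, so that products of elements
  of different summands vanish, and every element of \<open>A\<close> has a unique expansion.
\<close>

definition algebra_direct_sum ::
  "'i set \<Rightarrow> ('i, 'f::field) matrix set \<Rightarrow> 'g set \<Rightarrow> ('g \<Rightarrow> ('i, 'f) matrix set) \<Rightarrow> bool" where
  "algebra_direct_sum X A G B \<longleftrightarrow>
     finite G \<and> (\<forall>g\<in>G. two_sided_ideal X A (B g)) \<and>
     (\<forall>M\<in>A. \<exists>!N. N \<in> PiE G B \<and> M = (\<Sum>g\<in>G. N g))"


section \<open>The factorial scheme and its Terwilliger algebra\<close>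

text \<open>
  The sets $U_1, \dots, U_n$ are given by the values of \<open>U\<close> on \<open>{1..n}\<close>; elements of the product
  are extensional functions on \<open>{1..n}\<close>.
\<close>

definition XX :: "nat \<Rightarrow> (nat \<Rightarrow> 'u set) \<Rightarrow> (nat \<Rightarrow> 'u) set" where
  "XX n U = PiE {1..n} U"

definition EE :: "nat \<Rightarrow> nat set set" where
  "EE n = Pow {1..n}"

definition RR :: "nat \<Rightarrow> (nat \<Rightarrow> 'u set) \<Rightarrow> nat set \<Rightarrow> ((nat \<Rightarrow> 'u) \<times> (nat \<Rightarrow> 'u)) set" where
  "RR n U h = {(y, z). y \<in> XX n U \<and> z \<in> XX n U \<and> (\<forall>a\<in>{1..n}. y a \<noteq> z a \<longleftrightarrow> a \<in> h)}"

definition adj_mat :: "nat \<Rightarrow> (nat \<Rightarrow> 'u set) \<Rightarrow> nat set \<Rightarrow> (nat \<Rightarrow> 'u, 'f::field) matrix" where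
  "adj_mat n U h = (\<lambda>y z. if (y, z) \<in> RR n U h then 1 else 0)"

definition dual_idem ::
  "nat \<Rightarrow> (nat \<Rightarrow> 'u set) \<Rightarrow> (nat \<Rightarrow> 'u) \<Rightarrow> nat set \<Rightarrow> (nat \<Rightarrow> 'u, 'f::field) matrix" where
  "dual_idem n U x h = (\<lambda>y z. if y = z \<and> (x, y) \<in> RR n U h then 1 else 0)"

definition terwilliger ::
  "nat \<Rightarrow> (nat \<Rightarrow> 'u set) \<Rightarrow> (nat \<Rightarrow> 'u) \<Rightarrow> (nat \<Rightarrow> 'u, 'f::field) matrix set" where
  "terwilliger n U x =
     mat_subalgebra (XX n U) hull (adj_mat n U ` EE n \<union> dual_idem n U x ` EE n)"


section \<open>The elements $B_{a,b,c}$, $D_{a,b,c}$ and $D_m$\<close>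

text \<open>In the following definitions \<open>p\<close> stands for the characteristic of the field.\<close>

definition valency :: "(nat \<Rightarrow> 'u set) \<Rightarrow> nat set \<Rightarrow> nat" where
  "valency U h = (\<Prod>a\<in>h. card (U a) - 1)"

definition circ_part :: "(nat \<Rightarrow> 'u set) \<Rightarrow> nat set \<Rightarrow> nat set" where
  "circ_part U V = {a \<in> V. card (U a) \<noteq> 2}"

definition minus_part :: "nat \<Rightarrow> (nat \<Rightarrow> 'u set) \<Rightarrow> nat set \<Rightarrow> nat set" where
  "minus_part p U V = {a \<in> V. card (U a) \<noteq> 2 \<and> \<not> p dvd card (U a) - 1}"

definition n_minus :: "nat \<Rightarrow> nat \<Rightarrow> (nat \<Rightarrow> 'u set) \<Rightarrow> nat" where
  "n_minus p n U = card (minus_part p U {1..n})"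

definition PP :: "nat \<Rightarrow> (nat \<Rightarrow> 'u set) \<Rightarrow> (nat set \<times> nat set \<times> nat set) set" where
  "PP n U = {(a, b, c). a \<in> EE n \<and> b \<in> EE n \<and> c \<in> EE n \<and>
     sym_diff a c \<subseteq> b \<and> b \<subseteq> sym_diff a c \<union> circ_part U (a \<inter> c)}"

definition B_mat :: "nat \<Rightarrow> (nat \<Rightarrow> 'u set) \<Rightarrow> (nat \<Rightarrow> 'u) \<Rightarrow>
    nat set \<Rightarrow> nat set \<Rightarrow> nat set \<Rightarrow> (nat \<Rightarrow> 'u, 'f::field) matrix" where
  "B_mat n U x a b c =
     (\<Sum>j | sym_diff a c \<subseteq> j \<and> j \<subseteq> b.
        mat_mult (XX n U) (mat_mult (XX n U) (dual_idem n U x a) (adj_mat n U j)) (dual_idem n U x c))"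

definition D_mat :: "nat \<Rightarrow> (nat \<Rightarrow> 'u set) \<Rightarrow> (nat \<Rightarrow> 'u) \<Rightarrow>
    nat set \<Rightarrow> nat set \<Rightarrow> nat set \<Rightarrow> (nat \<Rightarrow> 'u, 'f::field) matrix" where
  "D_mat n U x a b c =
     (\<Sum>q | q \<in> EE n \<and> b \<subseteq> q \<and> q \<subseteq> sym_diff a c \<union> circ_part U (a \<inter> c) \<and> \<not> CHAR('f) dvd valency U q.
        mat_scale ((- 1) ^ card (q - b) * inverse (of_nat (valency U (c \<inter> q)))) (B_mat n U x a q c))"

definition diag_triples ::
  "nat \<Rightarrow> nat \<Rightarrow> (nat \<Rightarrow> 'u set) \<Rightarrow> (nat set \<times> nat set \<times> nat set) set" where
  "diag_triples p n U = {(a, b, c). (a, b, c) \<in> PP n U \<and> c = a \<and> \<not> p dvd valency U b}"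

definition diag_equiv ::
  "nat \<Rightarrow> nat \<Rightarrow> (nat \<Rightarrow> 'u set) \<Rightarrow> ((nat set \<times> nat set \<times> nat set) \<times> (nat set \<times> nat set \<times> nat set)) set"
  where
  "diag_equiv p n U = {((a, b, c), (a', b', c')).
     (a, b, c) \<in> diag_triples p n U \<and> (a', b', c') \<in> diag_triples p n U \<and>
     minus_part p U a - b = minus_part p U a' - b'}"

definition diag_classes ::
  "nat \<Rightarrow> nat \<Rightarrow> (nat \<Rightarrow> 'u set) \<Rightarrow> (nat set \<times> nat set \<times> nat set) set set" where
  "diag_classes p n U = diag_triples p n U // diag_equiv p n U"

definition D_sum :: "nat \<Rightarrow> (nat \<Rightarrow> 'u set) \<Rightarrow> (nat \<Rightarrow> 'u) \<Rightarrow>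
    (nat set \<times> nat set \<times> nat set) set \<Rightarrow> (nat \<Rightarrow> 'u, 'f::field) matrix" where
  "D_sum n U x C = (\<Sum>(a, b, c)\<in>C. D_mat n U x a b c)"

lemma equiv_diag_equiv: "equiv (diag_triples p n U) (diag_equiv p n U)"
  unfolding diag_equiv_def
  by (rule equivI) (auto simp: refl_on_def sym_def trans_def)

text \<open>
  The following facts show that enumerations of the classes by \<open>{1..2 ^ n_minus p n U}\<close> exist.
\<close>

lemma card_diag_classes:
  assumes "p \<noteq> 1"
  shows "card (diag_classes p n U) = 2 ^ n_minus p n U"
proof -
  define N where "N = minus_part p U {1..n}"
  define rep where "rep S = (S, {} :: nat set, S)" for S :: "nat set"
  have minusN: "minus_part p U S = S" if "S \<subseteq> N" for S
    using that by (auto simp: N_def minus_part_def)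
  have rep: "rep S \<in> diag_triples p n U" if "S \<subseteq> N" for S
    using that assms by (auto simp: N_def minus_part_def rep_def diag_triples_def PP_def EE_def valency_def)
  have "bij_betw (\<lambda>S. diag_equiv p n U `` {rep S}) (Pow N) (diag_classes p n U)"
  proof (rule bij_betwI')
    fix S T assume *: "S \<in> Pow N" "T \<in> Pow N"
    have "diag_equiv p n U `` {rep S} = diag_equiv p n U `` {rep T} \<longleftrightarrow> (rep S, rep T) \<in> diag_equiv p n U"
      using * by (intro eq_equiv_class_iff[OF equiv_diag_equiv] rep) auto
    also have "\<dots> \<longleftrightarrow> S = T"
      using * rep[of S] rep[of T] minusN[of S] minusN[of T] by (auto simp: diag_equiv_def rep_def)
    finally show "diag_equiv p n U `` {rep S} = diag_equiv p n U `` {rep T} \<longleftrightarrow> S = T" .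
  next
    fix S assume "S \<in> Pow N"
    then show "diag_equiv p n U `` {rep S} \<in> diag_classes p n U"
      unfolding diag_classes_def by (intro quotientI rep) auto
  next
    fix C assume "C \<in> diag_classes p n U"
    then obtain t where t: "t \<in> diag_triples p n U" "C = diag_equiv p n U `` {t}"
      unfolding diag_classes_def by (rule quotientE)
    obtain a b c where abc: "t = (a, b, c)" by (cases t)
    define S where "S = minus_part p U a - b"
    have S: "S \<subseteq> N"
      using t(1) by (auto simp: abc S_def N_def minus_part_def diag_triples_def PP_def EE_def)
    have "(t, rep S) \<in> diag_equiv p n U"
      using t(1) rep[OF S] minusN[OF S] by (auto simp: abc diag_equiv_def rep_def S_def)
    then have "C = diag_equiv p n U `` {rep S}"
      unfolding t(2) by (rule equiv_class_eq[OF equiv_diag_equiv])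
    then show "\<exists>S\<in>Pow N. C = diag_equiv p n U `` {rep S}"
      using S by blast
  qed
  then have "card (diag_classes p n U) = card (Pow N)"
    by (simp add: bij_betw_same_card)
  also have "\<dots> = 2 ^ n_minus p n U"
    by (simp add: card_Pow N_def n_minus_def minus_part_def)
  finally show ?thesis .
qed

lemma diag_classes_enumeration:
  "\<exists>\<C> :: nat \<Rightarrow> _. bij_betw \<C> {1..2 ^ n_minus CHAR('f::field) n U} (diag_classes CHAR('f) n U)"
proof -
  have "card (diag_classes CHAR('f) n U) = 2 ^ n_minus CHAR('f) n U"
    by (rule card_diag_classes) simp
  moreover from this have "finite (diag_classes CHAR('f) n U)"
    by (intro card_ge_0_finite) simp
  ultimately show ?thesis
    using ex_bij_betw_nat_finite_1 by metis
qed

end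

theory Submission
  imports Defs
begin

text \<open>
  The algebra \<open>T\<close> is spanned by Kronecker products of matrices from the Terwilliger algebras of the
  one-class schemes on the sets \<open>U i\<close>, so everything reduces to these five-dimensional local
  algebras. The local algebra has exactly two block idempotents, with \<open>I'\<close> and \<open>J'\<close> the identity and
  the all-ones matrix on the complement of the base point, namely \<open>I' - J'/k\<close> and its complement,
  if \<open>k = |U i| - 1\<close> is nonzero in the field and \<open>|U i| \<noteq> 2\<close>; otherwise its center is local.
  The products of local idempotents are the \<open>D\<^sub>m\<close>, indexed by the set \<open>S\<close> of places carrying \<open>I' - J'/k\<close>.

  To see that \<open>D\<^sub>m\<close> is primitive in the center, cut down by the dual idempotent of \<open>S\<close>, which leaves a
  one-dimensional algebra. It remains to show that a central idempotent \<open>f = f D\<^sub>m\<close> killed by this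
  dual idempotent is zero. One place outside \<open>S\<close> is released at a time: if \<open>k \<noteq> 0\<close> there, the new
  diagonal part lies in the ideal generated by the old one; if \<open>k = 0\<close>, the new part of \<open>f\<close> has a factor
  \<open>J'\<close> at this place, hence is square-zero and idempotent.
\<close>

section \<open>Matrix algebra over a finite index set\<close>

lemma mat_mult_assoc: "mat_mult X (mat_mult X L M) N = mat_mult X L (mat_mult X M N)"
proof (intro ext)
  fix y z
  have "mat_mult X (mat_mult X L M) N y z = (\<Sum>w\<in>X. \<Sum>v\<in>X. L y v * M v w * N w z)"
    by (simp add: mat_mult_def sum_distrib_right)
  also have "\<dots> = (\<Sum>v\<in>X. \<Sum>w\<in>X. L y v * M v w * N w z)"
    by (rule sum.swap)
  finally show "mat_mult X (mat_mult X L M) N y z = mat_mult X L (mat_mult X M N) y z"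
    by (simp add: mat_mult_def sum_distrib_left mult.assoc)
qed

lemma mat_mult_add_left: "mat_mult X (L + M) N = mat_mult X L N + mat_mult X M N"
  and mat_mult_add_right: "mat_mult X N (L + M) = mat_mult X N L + mat_mult X N M"
  and mat_mult_diff_left: "mat_mult X (L - M) N = mat_mult X L N - mat_mult X M N"
  and mat_mult_diff_right: "mat_mult X N (L - M) = mat_mult X N L - mat_mult X N M"
  and mat_mult_0_left [simp]: "mat_mult X 0 N = 0"
  and mat_mult_0_right [simp]: "mat_mult X N 0 = 0"
  and mat_mult_scale_left: "mat_mult X (mat_scale c M) N = mat_scale c (mat_mult X M N)"
  and mat_mult_scale_right: "mat_mult X M (mat_scale c N) = mat_scale c (mat_mult X M N)"
  by (auto simp: mat_mult_def mat_scale_def fun_eq_iff algebra_simps sum.distrib sum_subtractf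
      sum_distrib_left)

lemma sum_mat_apply: "(\<Sum>g\<in>G. M g) y z = (\<Sum>g\<in>G. M g y z)"
  for M :: "'g \<Rightarrow> ('i, 'f::field) matrix"
  by (induction G rule: infinite_finite_induct) auto

lemma mat_mult_sum_left: "mat_mult X (\<Sum>g\<in>G. M g) N = (\<Sum>g\<in>G. mat_mult X (M g) N)"
  and mat_mult_sum_right: "mat_mult X N (\<Sum>g\<in>G. M g) = (\<Sum>g\<in>G. mat_mult X N (M g))"
  by (intro ext, simp add: mat_mult_def sum_mat_apply sum_distrib_left sum_distrib_right,
      rule sum.swap)+

lemma mat_mult_one_right:
  assumes "finite X" "M \<in> mat_carrier X"
  shows "mat_mult X M (mat_one X) = M"
proof (intro ext)
  fix y z
  have "(\<Sum>w\<in>X. M y w * (if w \<in> X \<and> w = z then 1 else 0)) = (\<Sum>w\<in>X. if w = z then M y w else 0)"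
    by (intro sum.cong) auto
  also have "\<dots> = M y z"
    using assms by (auto simp: mat_carrier_def)
  finally show "mat_mult X M (mat_one X) y z = M y z"
    by (simp add: mat_mult_def mat_one_def)
qed

text \<open>By bilinearity a product of two spans is controlled by products of generators. It is
  used with \<open>Z\<close> a span, to get closure under multiplication, and with
  \<open>Z = {0}\<close>, to get a vanishing product.\<close>

lemma span_mat_mult:
  assumes "mat.subspace Z" "\<And>M N. M \<in> P \<Longrightarrow> N \<in> Q \<Longrightarrow> mat_mult X M N \<in> Z"
    and "M \<in> mat.span P" "N \<in> mat.span Q"
  shows "mat_mult X M N \<in> Z"
proof -
  have "mat_mult X M N \<in> Z" if "M \<in> P" for M
    using assms(4)
  proof (induction rule: mat.span_induct)
    case base
    show ?case
      using assms(1) by (auto simp: mat.subspace_def mat_mult_add_right mat_mult_scale_right)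
  next
    case (step N)
    then show ?case using that assms(2) by simp
  qed
  note * = this
  show ?thesis
    using assms(3)
  proof (induction rule: mat.span_induct)
    case base
    show ?case
      using assms(1) by (auto simp: mat.subspace_def mat_mult_add_left mat_mult_scale_left)
  next
    case (step N)
    then show ?case using * by simp
  qed
qed

section \<open>Generated subalgebras and their centers\<close>

lemma mat_carrier_eq: "mat_carrier X = {M. \<forall>y z. y \<notin> X \<or> z \<notin> X \<longrightarrow> M y z = 0}"
  by (auto simp: mat_carrier_def)

lemma subspace_mat_carrier: "mat.subspace (mat_carrier X)"
  by (simp add: mat.subspace_def mat_carrier_eq mat_scale_def)

lemma mat_mult_carrier:
  assumes "M \<in> mat_carrier X" "N \<in> mat_carrier X"
  shows "mat_mult X M N \<in> mat_carrier X"
proof -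
  have "mat_mult X M N y z = 0" if "y \<notin> X \<or> z \<notin> X" for y z
    using assms that unfolding mat_mult_def mat_carrier_def by (intro sum.neutral) force
  then show ?thesis by (auto simp: mat_carrier_def)
qed

lemma mat_subalgebra_carrier: "mat_subalgebra X (mat_carrier X)"
  by (auto simp: mat_subalgebra_def subspace_mat_carrier mat_mult_carrier)
     (auto simp: mat_carrier_def mat_one_def)

text \<open>Intersections of subalgebras are subalgebras, provided that the intersected family is
  nonempty. The hypothesis on \<open>G\<close> puts \<open>mat_carrier X\<close> into the
  family.\<close>

lemma mat_subalgebra_hull:
  assumes "G \<subseteq> mat_carrier X"
  shows "mat_subalgebra X (mat_subalgebra X hull G)"
proof -
  have *: "mat_subalgebra X hull G \<subseteq> mat_carrier X"
    by (intro hull_minimal assms mat_subalgebra_carrier)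
  have "mat.subspace (mat_subalgebra X hull G)"
    unfolding hull_def by (rule mat.subspace_Inter) (auto simp: mat_subalgebra_def)
  then show ?thesis
    using * unfolding mat_subalgebra_def by (auto simp: hull_def)
qed

lemma alg_centerD: "M \<in> alg_center X A \<Longrightarrow> M \<in> A"
  "M \<in> alg_center X A \<Longrightarrow> N \<in> A \<Longrightarrow> mat_mult X M N = mat_mult X N M"
  by (auto simp: alg_center_def)

lemma alg_center_diff:
  assumes "mat_subalgebra X A" "M \<in> alg_center X A" "N \<in> alg_center X A"
  shows "M - N \<in> alg_center X A"
proof -
  have "M - N \<in> A"
    using assms(1) alg_centerD(1)[OF assms(2)] alg_centerD(1)[OF assms(3)]
    by (auto simp: mat_subalgebra_def intro: mat.subspace_diff)
  then show ?thesis
    using alg_centerD(2)[OF assms(2)] alg_centerD(2)[OF assms(3)]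
    by (simp add: alg_center_def mat_mult_diff_left mat_mult_diff_right)
qed

lemma alg_center_mult:
  assumes "mat_subalgebra X A" "M \<in> alg_center X A" "N \<in> alg_center X A"
  shows "mat_mult X M N \<in> alg_center X A"
proof -
  have "mat_mult X (mat_mult X M N) L = mat_mult X L (mat_mult X M N)" if "L \<in> A" for L
    by (metis that alg_centerD(2)[OF assms(2)] alg_centerD(2)[OF assms(3)] mat_mult_assoc)
  then show ?thesis
    using assms(1) alg_centerD(1)[OF assms(2)] alg_centerD(1)[OF assms(3)]
    unfolding mat_subalgebra_def by (auto simp: alg_center_def)
qed


section \<open>Blocks from a complete set of central idempotents\<close>

text \<open>The condition \<open>indecomposable\<close> is primitivity in usable form: the corner of
  the center cut out by \<open>D g\<close> contains no idempotents other than 0 and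
  \<open>D g\<close>.\<close>

locale central_decomposition =
  fixes X :: "'i set" and A :: "('i, 'f::field) matrix set" and G :: "'g set"
    and D :: "'g \<Rightarrow> ('i, 'f) matrix"
  assumes finite_X: "finite X" and subalgebra: "mat_subalgebra X A" and finite_G: "finite G"
    and central: "g \<in> G \<Longrightarrow> D g \<in> alg_center X A"
    and nonzero: "g \<in> G \<Longrightarrow> D g \<noteq> 0"
    and idem: "g \<in> G \<Longrightarrow> mat_mult X (D g) (D g) = D g"
    and orth: "g \<in> G \<Longrightarrow> h \<in> G \<Longrightarrow> g \<noteq> h \<Longrightarrow> mat_mult X (D g) (D h) = 0"
    and total: "(\<Sum>g\<in>G. D g) = mat_one X"
    and indecomposable: "g \<in> G \<Longrightarrow> f \<in> alg_center X A \<Longrightarrow> mat_mult X f f = f \<Longrightarrow>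
      mat_mult X f (D g) = f \<Longrightarrow> f = 0 \<or> f = D g"
begin

lemma in_algebra: "g \<in> G \<Longrightarrow> D g \<in> A"
  using central by (auto simp: alg_center_def)

lemma commute: "g \<in> G \<Longrightarrow> M \<in> A \<Longrightarrow> mat_mult X (D g) M = mat_mult X M (D g)"
  using central by (auto simp: alg_center_def)

text \<open>Equal values at distinct indices would be orthogonal to each other, so the common value
  would be its own square and zero.\<close>

lemma inj: "inj_on D G"
  by (rule inj_onI) (metis idem nonzero orth)

lemma expand: "M \<in> A \<Longrightarrow> M = (\<Sum>g\<in>G. mat_mult X M (D g))"
  using subalgebra finite_X
  by (simp add: total flip: mat_mult_sum_right) (simp add: mat_mult_one_right subset_iff mat_subalgebra_def)

text \<open>A summand \<open>f\<close> of an orthogonal decomposition of \<open>D g\<close>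
  satisfies \<open>f D g = f\<close>, hence equals \<open>D g\<close>. So a decomposition has only
  one member.\<close>

lemma primitive:
  assumes g: "g \<in> G"
  shows "primitive_idempotent X (alg_center X A) (D g)"
  unfolding primitive_idempotent_def
proof (intro conjI notI)
  show "D g \<in> alg_center X A" "nonzero_idempotent X (D g)"
    using g by (auto simp: central nonzero_idempotent_def nonzero idem)
  assume "\<exists>S. finite S \<and> card S \<ge> 2 \<and> S \<subseteq> alg_center X A \<and>
            (\<forall>f\<in>S. nonzero_idempotent X f) \<and>
            (\<forall>f\<in>S. \<forall>g\<in>S. f \<noteq> g \<longrightarrow> mat_mult X f g = 0) \<and> D g = (\<Sum>f\<in>S. f)"
  then obtain S where S: "finite S" "card S \<ge> 2" "S \<subseteq> alg_center X A"
    "\<And>f. f \<in> S \<Longrightarrow> nonzero_idempotent X f"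
    "\<And>f g. f \<in> S \<Longrightarrow> g \<in> S \<Longrightarrow> f \<noteq> g \<Longrightarrow> mat_mult X f g = 0" "D g = (\<Sum>f\<in>S. f)"
    by blast
  have "f = D g" if f: "f \<in> S" for f
  proof -
    have "mat_mult X f (D g) = (\<Sum>h\<in>S. mat_mult X f h)"
      by (simp add: S(6) mat_mult_sum_right)
    also have "\<dots> = mat_mult X f f + (\<Sum>h\<in>S - {f}. mat_mult X f h)"
      using S(1) f by (simp add: sum.remove)
    also have "(\<Sum>h\<in>S - {f}. mat_mult X f h) = 0"
      using S(5) f by (intro sum.neutral) auto
    also have "mat_mult X f f + 0 = f"
      using S(4) f by (simp add: nonzero_idempotent_def)
    finally show ?thesis
      using indecomposable[OF g, of f] S(3,4) f by (auto simp: nonzero_idempotent_def)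
  qed
  then have "card S \<le> card {D g}"
    by (intro card_mono) auto
  then show False using S(2) by simp
qed

text \<open>Each product \<open>e D g\<close> is a central idempotent below \<open>D g\<close>,
  hence 0 or \<open>D g\<close>. So \<open>e\<close> is the sum of those \<open>D g\<close> that it
  does not kill, and primitivity leaves exactly one of them.\<close>

lemma primitive_cases:
  assumes "primitive_idempotent X (alg_center X A) e"
  shows "e \<in> D ` G"
proof -
  have e: "e \<in> alg_center X A" "e \<noteq> 0" "mat_mult X e e = e" "e \<in> A"
    using assms by (auto simp: primitive_idempotent_def nonzero_idempotent_def alg_center_def)
  define H where "H = {g \<in> G. mat_mult X e (D g) \<noteq> 0}"
  have HG: "H \<subseteq> G" and finH: "finite H"
    using finite_G by (auto simp: H_def)
  have eD: "mat_mult X e (D g) = D g" if "g \<in> H" for g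
  proof -
    have g: "g \<in> G" using that HG by auto
    have "mat_mult X (mat_mult X e (D g)) (mat_mult X e (D g)) = mat_mult X (mat_mult X e e) (mat_mult X (D g) (D g))"
      by (metis commute[OF g e(4)] mat_mult_assoc)
    then have "mat_mult X e (D g) = 0 \<or> mat_mult X e (D g) = D g"
      using g e by (intro indecomposable alg_center_mult[OF subalgebra] central) (auto simp: idem mat_mult_assoc)
    then show ?thesis using that by (auto simp: H_def)
  qed
  have "e = (\<Sum>g\<in>G. mat_mult X e (D g))"
    by (rule expand) fact
  also have "\<dots> = (\<Sum>g\<in>H. D g)"
    using finite_G eD by (intro sum.mono_neutral_cong_right) (auto simp: H_def)
  finally have eH: "e = (\<Sum>g\<in>H. D g)" .
  have injH: "inj_on D H" using inj HG by (rule inj_on_subset)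
  have eq: "e = (\<Sum>f\<in>D ` H. f)"
    using eH injH by (simp add: sum.reindex)
  have "\<not> card (D ` H) \<ge> 2"
  proof -
    have "\<forall>f\<in>D ` H. nonzero_idempotent X f"
      and "\<forall>f\<in>D ` H. \<forall>g\<in>D ` H. f \<noteq> g \<longrightarrow> mat_mult X f g = 0"
      and "D ` H \<subseteq> alg_center X A" "finite (D ` H)"
      using HG finH by (auto simp: nonzero_idempotent_def nonzero idem central subset_iff intro!: orth)
    then show ?thesis
      using eq assms unfolding primitive_idempotent_def by blast
  qed
  then have "card H < 2"
    using injH by (simp add: card_image)
  moreover have "H \<noteq> {}"
    using e(2) eH by auto
  ultimately have "card H = 1"
    using finH by (metis One_nat_def Suc_1 card_0_eq less_2_cases)
  then obtain g where "H = {g}"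
    by (auto simp: card_1_singleton_iff)
  then show ?thesis
    using eH HG by auto
qed

lemma Bl_eq: "Bl X A = D ` G"
  using primitive primitive_cases by (auto simp: Bl_def)

text \<open>If \<open>D g\<close> were of the form \<open>M D h\<close>, multiplying by
  \<open>D g\<close> on the right would give \<open>D g = 0\<close> by orthogonality.\<close>

lemma inj_block_algebra: "inj_on (\<lambda>g. block_algebra X A (D g)) G"
proof (rule inj_onI, rule ccontr)
  fix g h assume g: "g \<in> G" "h \<in> G" "block_algebra X A (D g) = block_algebra X A (D h)" "g \<noteq> h"
  have "D g \<in> block_algebra X A (D g)"
    using idem[OF g(1)] in_algebra[OF g(1)] by (force simp: block_algebra_def)
  then obtain M where "D g = mat_mult X M (D h)"
    using g by (auto simp: block_algebra_def)
  then have "mat_mult X (D g) (D g) = mat_mult X M (mat_mult X (D h) (D g))"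
    by (metis mat_mult_assoc)
  then show False
    using g idem nonzero orth by fastforce
qed

text \<open>Right multiplication by an idempotent is a projection, so its image is its set of fixed
  points. In this form the ideal property and the uniqueness of expansions become equations.\<close>

lemma block_algebra_eq:
  assumes "g \<in> G"
  shows "block_algebra X A (D g) = {M \<in> A. mat_mult X M (D g) = M}"
proof -
  have "mat_mult X (mat_mult X M (D g)) (D g) = mat_mult X M (D g)" "M \<in> A \<Longrightarrow> mat_mult X M (D g) \<in> A" for M
    using assms subalgebra by (auto simp: mat_mult_assoc idem mat_subalgebra_def in_algebra)
  then show ?thesis by (force simp: block_algebra_def)
qed

lemma direct_sum: "algebra_direct_sum X A G (\<lambda>g. block_algebra X A (D g))"
  unfolding algebra_direct_sum_def
proof (intro conjI ballI finite_G)
  fix g assume g: "g \<in> G"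
  have "mat.subspace {M \<in> A. mat_mult X M (D g) = M}"
    using subalgebra unfolding mat_subalgebra_def mat.subspace_def
    by (auto simp: mat_mult_add_left mat_mult_scale_left)
  moreover have "mat_mult X M N \<in> A \<and> mat_mult X N M \<in> A \<and>
      mat_mult X (mat_mult X M N) (D g) = mat_mult X M N \<and>
      mat_mult X (mat_mult X N M) (D g) = mat_mult X N M"
    if "M \<in> A" "N \<in> A" "mat_mult X N (D g) = N" for M N
  proof -
    have "mat_mult X (mat_mult X N M) (D g) = mat_mult X N M"
      using that commute[OF g] by (metis mat_mult_assoc)
    then show ?thesis
      using that subalgebra by (auto simp: mat_mult_assoc mat_subalgebra_def)
  qed
  ultimately show "two_sided_ideal X A (block_algebra X A (D g))"
    unfolding two_sided_ideal_def block_algebra_eq[OF g] by auto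
next
  fix M assume M: "M \<in> A"
  let ?B = "\<lambda>g. block_algebra X A (D g)"
  show "\<exists>!N. N \<in> PiE G ?B \<and> M = (\<Sum>g\<in>G. N g)"
  proof (rule ex1I[of _ "\<lambda>g\<in>G. mat_mult X M (D g)"])
    show "(\<lambda>g\<in>G. mat_mult X M (D g)) \<in> PiE G ?B \<and> M = (\<Sum>g\<in>G. (\<lambda>g\<in>G. mat_mult X M (D g)) g)"
      using M expand[OF M] by (auto simp: block_algebra_def)
  next
    fix N assume N: "N \<in> PiE G ?B \<and> M = (\<Sum>g\<in>G. N g)"
    have "mat_mult X M (D g) = N g" if g: "g \<in> G" for g
    proof -
      \<comment> \<open>Right multiplication by \<open>D g\<close> fixes the component
        \<open>N g\<close> and kills all others, so each component can be read off from
        \<open>M\<close>.\<close>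
      have *: "mat_mult X (N h) (D g) = (if h = g then N g else 0)" if h: "h \<in> G" for h
      proof -
        have "mat_mult X (N h) (D h) = N h"
          using N h block_algebra_eq[OF h] by auto
        moreover from this have "mat_mult X (N h) (D g) = mat_mult X (N h) (mat_mult X (D h) (D g))"
          by (metis mat_mult_assoc)
        ultimately show ?thesis
          using orth[OF h g] by auto
      qed
      have "mat_mult X M (D g) = (\<Sum>h\<in>G. mat_mult X (N h) (D g))"
        using N by (simp add: mat_mult_sum_left)
      also have "\<dots> = N g"
        using g finite_G * by simp
      finally show ?thesis .
    qed
    then show "N = (\<lambda>g\<in>G. mat_mult X M (D g))"
      using N by (intro ext) (auto simp: PiE_def extensional_def)
  qed
qed

end


section \<open>The Terwilliger algebra of a one-class scheme\<close>

text \<open>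
  A matrix invariant under the permutations of \<open>V\<close> that fix the base point \<open>v\<^sub>0\<close>: the parameters
  are the coefficients of the base entry, the base row, the base column, and the identity and
  all-ones matrices on \<open>V - {v\<^sub>0}\<close>.
\<close>

definition cell :: "'u set \<Rightarrow> 'u \<Rightarrow> 'f \<Rightarrow> 'f \<Rightarrow> 'f \<Rightarrow> 'f \<Rightarrow> 'f \<Rightarrow> ('u, 'f::field) matrix" where
  "cell V v\<^sub>0 \<alpha> \<beta> \<gamma> \<delta> \<epsilon> = (\<lambda>u v. if u \<in> V \<and> v \<in> V then
     (if u = v\<^sub>0 then (if v = v\<^sub>0 then \<alpha> else \<beta>)
      else (if v = v\<^sub>0 then \<gamma> else if u = v then \<delta> + \<epsilon> else \<epsilon>)) else 0)"

lemma cell_add: "cell V v\<^sub>0 \<alpha> \<beta> \<gamma> \<delta> \<epsilon> + cell V v\<^sub>0 \<alpha>' \<beta>' \<gamma>' \<delta>' \<epsilon>' =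
    cell V v\<^sub>0 (\<alpha> + \<alpha>') (\<beta> + \<beta>') (\<gamma> + \<gamma>') (\<delta> + \<delta>') (\<epsilon> + \<epsilon>')"
  and cell_scale: "mat_scale c (cell V v\<^sub>0 \<alpha> \<beta> \<gamma> \<delta> \<epsilon>) =
    cell V v\<^sub>0 (c * \<alpha>) (c * \<beta>) (c * \<gamma>) (c * \<delta>) (c * \<epsilon>)"
  by (auto simp: cell_def fun_eq_iff mat_scale_def algebra_simps)

text \<open>Block multiplication with respect to the base point and its complement \<open>W\<close>.
  The size \<open>k\<close> enters when an all-ones row or matrix meets an all-ones column or
  matrix; the coefficient \<delta> of the identity on \<open>W\<close> is simply
  multiplicative.\<close>

lemma cell_mult:
  fixes k \<alpha> :: "'f::field"
  assumes "finite V" "v\<^sub>0 \<in> V" and k: "k = of_nat (card V - 1)"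
  shows "mat_mult V (cell V v\<^sub>0 \<alpha> \<beta> \<gamma> \<delta> \<epsilon>) (cell V v\<^sub>0 \<alpha>' \<beta>' \<gamma>' \<delta>' \<epsilon>') =
    cell V v\<^sub>0 (\<alpha> * \<alpha>' + k * \<beta> * \<gamma>') (\<alpha> * \<beta>' + \<beta> * \<delta>' + k * \<beta> * \<epsilon>')
      (\<gamma> * \<alpha>' + \<delta> * \<gamma>' + k * \<epsilon> * \<gamma>') (\<delta> * \<delta>') (\<gamma> * \<beta>' + \<delta> * \<epsilon>' + \<epsilon> * \<delta>' + k * \<epsilon> * \<epsilon>')"
    (is "mat_mult V ?M ?N = ?R")
proof (intro ext)
  fix u v
  define W where "W = V - {v\<^sub>0}"
  have W: "finite W" "v\<^sub>0 \<notin> W" and k: "of_nat (card W) = k"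
    using assms by (auto simp: W_def)
  have V: "V = insert v\<^sub>0 W" using assms by (auto simp: W_def)
  have eq: "mat_mult V ?M ?N u v = ?M u v\<^sub>0 * ?N v\<^sub>0 v + (\<Sum>w\<in>W. ?M u w * ?N w v)"
    using W unfolding mat_mult_def V by (subst sum.insert) auto
  have M: "?M u w = (if u = v\<^sub>0 then \<beta> else \<delta> * of_bool (u = w) + \<epsilon>)" if "u \<in> V" "w \<in> W" for w
    using that W by (auto simp: cell_def V)
  have N: "?N w v = (if v = v\<^sub>0 then \<gamma>' else \<delta>' * of_bool (w = v) + \<epsilon>')" if "v \<in> V" "w \<in> W" for w
    using that W by (auto simp: cell_def V)
  have d: "(\<Sum>w\<in>W. c * of_bool (w = t)) = c" "(\<Sum>w\<in>W. c * of_bool (t = w)) = c"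
    if "t \<in> W" for t and c :: 'f
    using that W by (simp_all add: of_bool_def if_distrib[of "\<lambda>a. _ * a"] cong: if_cong)
  have d2: "(\<Sum>w\<in>W. c * (of_bool (u = w) * of_bool (w = v))) = c * of_bool (u = v)"
    if "u \<in> W" for c :: 'f
  proof -
    have "(\<Sum>w\<in>W. c * (of_bool (u = w) * of_bool (w = v))) = (\<Sum>w\<in>W. (c * of_bool (u = v)) * of_bool (u = w))"
      by (intro sum.cong) auto
    then show ?thesis using d(2)[OF that] by metis
  qed
  show "mat_mult V ?M ?N u v = ?R u v"
  proof (cases "u \<in> V \<and> v \<in> V")
    case False
    then show ?thesis unfolding mat_mult_def by (auto simp: cell_def)
  next
    case True
    then have "(\<Sum>w\<in>W. ?M u w * ?N w v) =
      (\<Sum>w\<in>W. (if u = v\<^sub>0 then \<beta> else \<delta> * of_bool (u = w) + \<epsilon>) *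
        (if v = v\<^sub>0 then \<gamma>' else \<delta>' * of_bool (w = v) + \<epsilon>'))"
      using M N by (intro sum.cong) auto
    also have "\<dots> = (if u = v\<^sub>0 then if v = v\<^sub>0 then k * \<beta> * \<gamma>' else \<beta> * \<delta>' + k * \<beta> * \<epsilon>'
        else if v = v\<^sub>0 then \<delta> * \<gamma>' + k * \<epsilon> * \<gamma>'
        else \<delta> * \<delta>' * of_bool (u = v) + \<delta> * \<epsilon>' + \<epsilon> * \<delta>' + k * \<epsilon> * \<epsilon>')"
    proof -
      have *: "w \<in> W" if "w \<in> V" "w \<noteq> v\<^sub>0" for w using that by (auto simp: W_def)
      \<comment> \<open>The facts 1 to 4 treat the base entry, the base row, the base column and the
        block on \<open>W\<close>.\<close>
      have 1: "(\<Sum>w\<in>W. \<beta> * \<gamma>') = k * \<beta> * \<gamma>'"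
        by (simp add: k)
      have 2: "(\<Sum>w\<in>W. \<beta> * (\<delta>' * of_bool (w = v) + \<epsilon>')) = \<beta> * \<delta>' + k * \<beta> * \<epsilon>'" if "v \<in> W"
        using d(1)[OF that, of "\<beta> * \<delta>'"] by (simp add: k distrib_left sum.distrib mult.assoc)
      have 3: "(\<Sum>w\<in>W. (\<delta> * of_bool (u = w) + \<epsilon>) * \<gamma>') = \<delta> * \<gamma>' + k * \<epsilon> * \<gamma>'" if "u \<in> W"
        using d(2)[OF that, of "\<delta> * \<gamma>'"] by (simp add: k distrib_right sum.distrib mult.assoc mult.commute[of \<gamma>'] mult.left_commute)
      have 4: "(\<Sum>w\<in>W. (\<delta> * of_bool (u = w) + \<epsilon>) * (\<delta>' * of_bool (w = v) + \<epsilon>')) =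
          \<delta> * \<delta>' * of_bool (u = v) + \<delta> * \<epsilon>' + \<epsilon> * \<delta>' + k * \<epsilon> * \<epsilon>'" if "u \<in> W" "v \<in> W"
      proof -
        have "(\<Sum>w\<in>W. (\<delta> * of_bool (u = w) + \<epsilon>) * (\<delta>' * of_bool (w = v) + \<epsilon>')) =
          (\<Sum>w\<in>W. \<delta> * \<delta>' * (of_bool (u = w) * of_bool (w = v)) + \<delta> * \<epsilon>' * of_bool (u = w) +
             \<epsilon> * \<delta>' * of_bool (w = v) + \<epsilon> * \<epsilon>')"
          by (intro sum.cong) (simp_all add: algebra_simps)
        also have "\<dots> = (\<Sum>w\<in>W. \<delta> * \<delta>' * (of_bool (u = w) * of_bool (w = v))) +
            (\<Sum>w\<in>W. \<delta> * \<epsilon>' * of_bool (u = w)) + (\<Sum>w\<in>W. \<epsilon> * \<delta>' * of_bool (w = v)) + k * (\<epsilon> * \<epsilon>')"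
          by (simp only: sum.distrib sum_constant k)
        finally show ?thesis
          by (simp only: d(1)[OF that(2)] d(2)[OF that(1)] d2[OF that(1)]) (simp add: mult.assoc)
      qed
      show ?thesis
        using True 1 2 3 4 by (cases "u = v\<^sub>0"; cases "v = v\<^sub>0") (simp_all add: *)
    qed
    finally show ?thesis
      unfolding eq using True assms(2) by (auto simp: cell_def algebra_simps)
  qed
qed

text \<open>Off the base point only one point remains, so I' = J' and only the sum of the last two
  parameters matters.\<close>

lemma cell_card_2:
  assumes "card V = 2" "v\<^sub>0 \<in> V"
  shows "cell V v\<^sub>0 \<alpha> \<beta> \<gamma> \<delta> \<epsilon> = cell V v\<^sub>0 \<alpha> \<beta> \<gamma> (\<delta> + \<epsilon>) 0"
proof -
  obtain a b where "V = {a, b}" using assms(1) by (auto simp: card_2_iff)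
  then show ?thesis using assms(2) by (auto simp: cell_def fun_eq_iff)
qed


section \<open>Kronecker products of local matrices\<close>

text \<open>The Kronecker product of the \<open>d i\<close>. The guard excludes non-extensional
  functions, whose values outside \<open>{1..n}\<close> the product over places cannot see.\<close>

definition tens :: "nat \<Rightarrow> (nat \<Rightarrow> 'u set) \<Rightarrow> (nat \<Rightarrow> ('u, 'f::field) matrix) \<Rightarrow> (nat \<Rightarrow> 'u, 'f) matrix" where
  "tens n U d = (\<lambda>y z. if y \<in> XX n U \<and> z \<in> XX n U then \<Prod>i\<in>{1..n}. d i (y i) (z i) else 0)"

lemma tens_cong: "(\<And>i. i \<in> {1..n} \<Longrightarrow> d i = d' i) \<Longrightarrow> tens n U d = tens n U d'"
  unfolding tens_def by (intro ext) (auto intro!: prod.cong)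

text \<open>The mixed-product rule: the distributive law turns a sum over all \<open>w\<close> in
  the product set into a product of sums, one for each place.\<close>

lemma tens_mult:
  assumes "\<And>i. i \<in> {1..n} \<Longrightarrow> finite (U i)"
  shows "mat_mult (XX n U) (tens n U d) (tens n U d') = tens n U (\<lambda>i. mat_mult (U i) (d i) (d' i))"
proof (intro ext)
  fix y z
  have "(\<Sum>w\<in>XX n U. (\<Prod>i\<in>{1..n}. d i (y i) (w i)) * (\<Prod>i\<in>{1..n}. d' i (w i) (z i))) =
    (\<Prod>i\<in>{1..n}. \<Sum>w\<in>U i. d i (y i) w * d' i w (z i))"
    using assms unfolding XX_def by (subst prod_sum_PiE) (auto simp: prod.distrib)
  then show "mat_mult (XX n U) (tens n U d) (tens n U d') y z = tens n U (\<lambda>i. mat_mult (U i) (d i) (d' i)) y z"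
    unfolding mat_mult_def tens_def by (auto intro!: sum.neutral)
qed

lemma tens_split:
  assumes "j \<in> {1..n}"
  shows "tens n U (d(j := m)) y z =
    (if y \<in> XX n U \<and> z \<in> XX n U then m (y j) (z j) * (\<Prod>i\<in>{1..n} - {j}. d i (y i) (z i)) else 0)"
proof -
  have "(\<Prod>i\<in>{1..n}. (d(j := m)) i (y i) (z i)) = m (y j) (z j) * (\<Prod>i\<in>{1..n} - {j}. d i (y i) (z i))"
    using assms by (subst prod.remove[of _ j]) auto
  then show ?thesis by (simp add: tens_def)
qed

lemma tens_add: "j \<in> {1..n} \<Longrightarrow> tens n U (d(j := l + m)) = tens n U (d(j := l)) + tens n U (d(j := m))"
  and tens_scale: "j \<in> {1..n} \<Longrightarrow> tens n U (d(j := mat_scale c m)) = mat_scale c (tens n U (d(j := m)))"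
  by (auto simp: tens_split fun_eq_iff mat_scale_def algebra_simps)

lemma tens_eq_0:
  assumes "j \<in> {1..n}" "d j = 0"
  shows "tens n U d = 0"
proof -
  have "tens n U (d(j := 0)) = 0"
    using assms(1) by (auto simp: tens_split fun_eq_iff)
  then show ?thesis using assms(2) by (metis fun_upd_triv)
qed

lemma tens_scale_all:
  "tens n U (\<lambda>i. mat_scale (c i) (d i)) = mat_scale (\<Prod>i\<in>{1..n}. c i) (tens n U d)"
  by (auto simp: tens_def mat_scale_def prod.distrib fun_eq_iff)

lemma tens_sum:
  assumes "q \<subseteq> {1..n}"
  shows "(\<Sum>j\<in>Pow q. tens n U (\<lambda>i. if i \<in> q then if i \<in> j then f i else g i else h i)) =
    tens n U (\<lambda>i. if i \<in> q then f i + g i else h i)"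
proof (intro ext)
  fix y z
  have split: "(\<Prod>i\<in>{1..n}. (if i \<in> q then k i else h i) (y i) (z i)) =
    (\<Prod>i\<in>q. k i (y i) (z i)) * (\<Prod>i\<in>{1..n} - q. h i (y i) (z i))" for k
  proof -
    have "(\<Prod>i\<in>{1..n}. (if i \<in> q then k i else h i) (y i) (z i)) =
      (\<Prod>i\<in>{1..n} - q. (if i \<in> q then k i else h i) (y i) (z i)) * (\<Prod>i\<in>q. (if i \<in> q then k i else h i) (y i) (z i))"
      using assms by (intro prod.subset_diff) auto
    then show ?thesis by (simp add: mult.commute)
  qed
  have q: "finite q" using assms by (rule finite_subset) simp
  have inner: "(\<Prod>i\<in>q. (if i \<in> j then f i else g i) (y i) (z i)) =
    (\<Prod>i\<in>j. f i (y i) (z i)) * (\<Prod>i\<in>q - j. g i (y i) (z i))" if "j \<subseteq> q" for j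
  proof -
    have "(\<Prod>i\<in>q. (if i \<in> j then f i else g i) (y i) (z i)) =
      (\<Prod>i\<in>q - j. (if i \<in> j then f i else g i) (y i) (z i)) * (\<Prod>i\<in>j. (if i \<in> j then f i else g i) (y i) (z i))"
      using that q by (intro prod.subset_diff) auto
    then show ?thesis by (simp add: mult.commute)
  qed
  show "(\<Sum>j\<in>Pow q. tens n U (\<lambda>i. if i \<in> q then if i \<in> j then f i else g i else h i)) y z =
    tens n U (\<lambda>i. if i \<in> q then f i + g i else h i) y z"
  proof (cases "y \<in> XX n U \<and> z \<in> XX n U")
    case True
    then have "(\<Sum>j\<in>Pow q. tens n U (\<lambda>i. if i \<in> q then if i \<in> j then f i else g i else h i)) y z =
      (\<Sum>j\<in>Pow q. (\<Prod>i\<in>j. f i (y i) (z i)) * (\<Prod>i\<in>q - j. g i (y i) (z i))) * (\<Prod>i\<in>{1..n} - q. h i (y i) (z i))"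
      unfolding sum_mat_apply sum_distrib_right
      by (intro sum.cong) (simp_all only: tens_def if_True simp_thms split inner Pow_iff)
    also have "\<dots> = (\<Prod>i\<in>q. f i (y i) (z i) + g i (y i) (z i)) * (\<Prod>i\<in>{1..n} - q. h i (y i) (z i))"
      using q by (simp add: prod_add)
    also have "\<dots> = tens n U (\<lambda>i. if i \<in> q then f i + g i else h i) y z"
      using True split[of "\<lambda>i. f i + g i"] by (simp add: tens_def)
    finally show ?thesis .
  next
    case False
    then show ?thesis by (auto simp: sum_mat_apply tens_def)
  qed
qed


section \<open>The factorial scheme\<close>

locale factorial_scheme =
  fixes n :: nat and U :: "nat \<Rightarrow> 'u set" and x :: "nat \<Rightarrow> 'u"
  assumes finite_U: "i \<in> {1..n} \<Longrightarrow> finite (U i)"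
    and card_U: "i \<in> {1..n} \<Longrightarrow> card (U i) \<ge> 2"
    and x_in: "x \<in> XX n U"
begin

abbreviation X where "X \<equiv> XX n U"
abbreviation T :: "(nat \<Rightarrow> 'u, 'f::field) matrix set" where "T \<equiv> terwilliger n U x"
abbreviation mm (infixl "\<odot>" 70) where "M \<odot> N \<equiv> mat_mult X M N"
abbreviation C where "C i \<equiv> cell (U i) (x i)"

definition local_alg :: "nat \<Rightarrow> ('u, 'f::field) matrix set" where
  "local_alg i = {C i \<alpha> \<beta> \<gamma> \<delta> \<epsilon> |\<alpha> \<beta> \<gamma> \<delta> \<epsilon>. True}"

lemma local_algI [simp, intro]: "C i \<alpha> \<beta> \<gamma> \<delta> \<epsilon> \<in> local_alg i"
  unfolding local_alg_def by (rule CollectI, (rule exI)+, rule conjI, rule refl, rule TrueI)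

lemma local_algE:
  assumes "m \<in> local_alg i"
  obtains \<alpha> \<beta> \<gamma> \<delta> \<epsilon> where "m = C i \<alpha> \<beta> \<gamma> \<delta> \<epsilon>"
  using assms unfolding local_alg_def by (elim CollectE exE conjE)

definition local_family :: "(nat \<Rightarrow> ('u, 'f::field) matrix) \<Rightarrow> bool" where
  "local_family d \<longleftrightarrow> (\<forall>i\<in>{1..n}. d i \<in> local_alg i)"

lemma finite_X: "finite X"
  unfolding XX_def by (intro finite_PiE finite_U) auto

lemma xU: "i \<in> {1..n} \<Longrightarrow> x i \<in> U i"
  using x_in by (auto simp: XX_def)

lemma C_mult: "i \<in> {1..n} \<Longrightarrow> mat_mult (U i) (C i \<alpha> \<beta> \<gamma> \<delta> \<epsilon>) (C i \<alpha>' \<beta>' \<gamma>' \<delta>' \<epsilon>') =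
    C i (\<alpha> * \<alpha>' + of_nat (card (U i) - 1) * \<beta> * \<gamma>') (\<alpha> * \<beta>' + \<beta> * \<delta>' + of_nat (card (U i) - 1) * \<beta> * \<epsilon>')
      (\<gamma> * \<alpha>' + \<delta> * \<gamma>' + of_nat (card (U i) - 1) * \<epsilon> * \<gamma>') (\<delta> * \<delta>')
      (\<gamma> * \<beta>' + \<delta> * \<epsilon>' + \<epsilon> * \<delta>' + of_nat (card (U i) - 1) * \<epsilon> * \<epsilon>')"
  by (rule cell_mult) (auto simp: finite_U xU)

lemma T_mult: "tens n U d \<odot> tens n U d' = tens n U (\<lambda>i. mat_mult (U i) (d i) (d' i))"
  by (rule tens_mult) (rule finite_U)

lemma local_alg_mult:
  assumes "i \<in> {1..n}" "l \<in> local_alg i" "m \<in> local_alg i"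
  shows "mat_mult (U i) l m \<in> local_alg i"
  using assms(2,3) by (elim local_algE) (simp only: C_mult[OF assms(1)] local_algI)

lemma C_zero: "C i 0 0 0 0 0 = 0"
  by (auto simp: cell_def fun_eq_iff)

text \<open>Membership in \<open>RR n U h\<close> is a conjunction of conditions on single places.
  \<open>C i 0 1 1 (-1) 1\<close> is the all-ones matrix minus the identity, encoding inequality;
  \<open>C i 1 0 0 1 0\<close> is the identity.\<close>

lemma adj_mat_eq: "(adj_mat n U h :: (nat \<Rightarrow> 'u, 'f::field) matrix) = tens n U (\<lambda>i. if i \<in> h then C i 0 1 1 (-1) 1 else C i 1 0 0 1 0)"
proof (intro ext)
  fix y z
  show "(adj_mat n U h y z :: 'f) = tens n U (\<lambda>i. if i \<in> h then C i 0 1 1 (-1) 1 else C i 1 0 0 1 0) y z"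
  proof (cases "y \<in> X \<and> z \<in> X")
    case True
    then have *: "y i \<in> U i" "z i \<in> U i" if "i \<in> {1..n}" for i
      using that by (auto simp: XX_def)
    have "(\<Prod>i\<in>{1..n}. (if i \<in> h then C i 0 1 1 (-1) 1 else C i 1 0 0 1 0) (y i) (z i) :: 'f) =
      (\<Prod>i\<in>{1..n}. of_bool (y i \<noteq> z i \<longleftrightarrow> i \<in> h))"
      using * by (intro prod.cong) (auto simp: cell_def)
    also have "\<dots> = of_bool (\<forall>i\<in>{1..n}. y i \<noteq> z i \<longleftrightarrow> i \<in> h)"
      by (auto intro!: prod.neutral)
    finally have "tens n U (\<lambda>i. if i \<in> h then C i 0 1 1 (-1) 1 else C i 1 0 0 1 0) y z =
        (of_bool (\<forall>i\<in>{1..n}. y i \<noteq> z i \<longleftrightarrow> i \<in> h) :: 'f)"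
      using True by (simp only: tens_def if_True simp_thms)
    moreover have "(adj_mat n U h y z :: 'f) = of_bool (\<forall>i\<in>{1..n}. y i \<noteq> z i \<longleftrightarrow> i \<in> h)"
      using True by (auto simp: adj_mat_def RR_def)
    ultimately show ?thesis by (simp only:)
  qed (auto simp: adj_mat_def RR_def tens_def)
qed

text \<open>Here \<open>C i 0 0 0 1 0\<close> is I', the projection away from the base point, and
  \<open>C i 1 0 0 0 0\<close> is the projection onto it.\<close>

lemma dual_idem_eq: "(dual_idem n U x h :: (nat \<Rightarrow> 'u, 'f::field) matrix) = tens n U (\<lambda>i. if i \<in> h then C i 0 0 0 1 0 else C i 1 0 0 0 0)"
proof (intro ext)
  fix y z
  show "(dual_idem n U x h y z :: 'f) = tens n U (\<lambda>i. if i \<in> h then C i 0 0 0 1 0 else C i 1 0 0 0 0) y z"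
  proof (cases "y \<in> X \<and> z \<in> X")
    case True
    then have *: "y i \<in> U i" "z i \<in> U i" if "i \<in> {1..n}" for i
      using that by (auto simp: XX_def)
    have "(\<Prod>i\<in>{1..n}. (if i \<in> h then C i 0 0 0 1 0 else C i 1 0 0 0 0) (y i) (z i) :: 'f) =
      (\<Prod>i\<in>{1..n}. of_bool (y i = z i \<and> (x i \<noteq> y i \<longleftrightarrow> i \<in> h)))"
      using * xU by (intro prod.cong) (auto simp: cell_def)
    also have "\<dots> = of_bool (\<forall>i\<in>{1..n}. y i = z i \<and> (x i \<noteq> y i \<longleftrightarrow> i \<in> h))"
      by (auto intro!: prod.neutral)
    also have "\<dots> = of_bool (y = z \<and> (\<forall>i\<in>{1..n}. x i \<noteq> y i \<longleftrightarrow> i \<in> h))"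
    proof -
      have "y = z \<longleftrightarrow> (\<forall>i\<in>{1..n}. y i = z i)"
        using True unfolding XX_def by (metis PiE_ext)
      then show ?thesis by auto
    qed
    finally have "tens n U (\<lambda>i. if i \<in> h then C i 0 0 0 1 0 else C i 1 0 0 0 0) y z =
        (of_bool (y = z \<and> (\<forall>i\<in>{1..n}. x i \<noteq> y i \<longleftrightarrow> i \<in> h)) :: 'f)"
      using True by (simp only: tens_def if_True simp_thms)
    moreover have "(dual_idem n U x h y z :: 'f) = of_bool (y = z \<and> (\<forall>i\<in>{1..n}. x i \<noteq> y i \<longleftrightarrow> i \<in> h))"
      using True x_in by (auto simp: dual_idem_def RR_def)
    ultimately show ?thesis by (simp only:)
  qed (auto simp: dual_idem_def RR_def tens_def)
qed

lemma mat_one_eq: "mat_one X = tens n U (\<lambda>i. C i 1 0 0 1 0)"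
proof -
  have "mat_one X = (adj_mat n U {} :: (nat \<Rightarrow> 'u, 'f::field) matrix)"
  proof (intro ext)
    fix y z
    have "y \<in> X \<and> y = z \<longleftrightarrow> (y, z) \<in> RR n U {}"
      unfolding RR_def XX_def by (auto intro: PiE_ext)
    then show "mat_one X y z = (adj_mat n U {} y z :: 'f)"
      by (simp add: mat_one_def adj_mat_def)
  qed
  then show ?thesis by (simp add: adj_mat_eq)
qed

lemma tens_carrier: "tens n U d \<in> mat_carrier X"
  by (auto simp: mat_carrier_def tens_def split: if_splits)

lemma T_subalgebra: "mat_subalgebra X T"
  unfolding terwilliger_def
  by (intro mat_subalgebra_hull) (auto simp: adj_mat_eq dual_idem_eq tens_carrier)

lemma local_family_mult: "local_family d \<Longrightarrow> local_family d' \<Longrightarrow> local_family (\<lambda>i. mat_mult (U i) (d i) (d' i))"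
  by (auto simp: local_family_def local_alg_mult)

text \<open>The span is itself a subalgebra containing the generators. Hence a statement linear in
  an element of \<open>T\<close> may be checked on a single Kronecker product. The reverse inclusion
  comes from \<open>tens_in_T\<close>.\<close>

lemma T_subset_span: "T \<subseteq> mat.span {tens n U d |d. local_family d}" (is "_ \<subseteq> mat.span ?G")
  unfolding terwilliger_def
proof (rule hull_minimal)
  show "mat_subalgebra X (mat.span ?G)"
    unfolding mat_subalgebra_def
  proof (intro conjI ballI)
    show "mat.span ?G \<subseteq> mat_carrier X"
      by (intro mat.span_minimal subspace_mat_carrier) (auto simp: tens_carrier)
    show "mat_one X \<in> mat.span ?G"
      by (rule mat.span_base) (force simp: mat_one_eq local_family_def)
    fix M N assume "M \<in> mat.span ?G" "N \<in> mat.span ?G"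
    then show "M \<odot> N \<in> mat.span ?G"
    proof (rule span_mat_mult[rotated 2])
      fix M N assume "M \<in> ?G" "N \<in> ?G"
      then show "M \<odot> N \<in> mat.span ?G"
        using local_family_mult by (fastforce simp: T_mult intro!: mat.span_base)
    qed simp
  qed simp
next
  show "adj_mat n U ` EE n \<union> dual_idem n U x ` EE n \<subseteq> mat.span ?G"
  proof (rule order_trans[OF _ mat.span_superset])
    have "local_family (\<lambda>i. if i \<in> h then C i 0 1 1 (-1) 1 else C i 1 0 0 1 0)"
      "local_family (\<lambda>i. if i \<in> h then C i 0 0 0 1 0 else C i 1 0 0 0 0)" for h
      by (auto simp: local_family_def)
    then show "adj_mat n U ` EE n \<union> dual_idem n U x ` EE n \<subseteq> ?G"
      unfolding adj_mat_eq dual_idem_eq by blast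
  qed
qed

section \<open>Kronecker products of local matrices lie in the Terwilliger algebra\<close>

definition emb :: "nat \<Rightarrow> ('u, 'f::field) matrix \<Rightarrow> (nat \<Rightarrow> 'u, 'f) matrix" where
  "emb j m = tens n U ((\<lambda>i. C i 1 0 0 1 0)(j := m))"

lemma T_closed: "M \<in> T \<Longrightarrow> N \<in> T \<Longrightarrow> M + N \<in> T" "M \<in> T \<Longrightarrow> mat_scale c M \<in> T"
  "M \<in> T \<Longrightarrow> N \<in> T \<Longrightarrow> M \<odot> N \<in> T" "mat_one X \<in> T"
  using T_subalgebra by (auto simp: mat_subalgebra_def mat.subspace_def)

lemma T_gen: "h \<subseteq> {1..n} \<Longrightarrow> adj_mat n U h \<in> T" "h \<subseteq> {1..n} \<Longrightarrow> dual_idem n U x h \<in> T"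
  unfolding terwilliger_def by (auto simp: EE_def intro!: hull_inc)

lemma T_sum: "(\<And>g. g \<in> G \<Longrightarrow> M g \<in> T) \<Longrightarrow> (\<Sum>g\<in>G. M g) \<in> T"
  using T_subalgebra by (auto simp: mat_subalgebra_def intro: mat.subspace_sum)

lemma emb_mult:
  assumes "j \<in> {1..n}"
  shows "emb j l \<odot> emb j m = emb j (mat_mult (U j) l m)"
  unfolding emb_def T_mult by (rule tens_cong) (auto simp: C_mult)

text \<open>The local algebra is generated by the projection onto the base point and the local
  adjacency matrix. The latter, embedded at \<open>j\<close>, is the adjacency matrix of
  \<open>{j}\<close>; the former is a sum of dual idempotents.\<close>

lemma emb_in_T:
  fixes m :: "('u, 'f::field) matrix"
  assumes j: "j \<in> {1..n}" and m: "m \<in> local_alg j"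
  shows "emb j m \<in> T"
proof -
  let ?T = "T :: (nat \<Rightarrow> 'u, 'f) matrix set"
  have add: "emb j (l + m) = emb j l + emb j m" for l m :: "('u, 'f) matrix"
    using j by (simp add: emb_def tens_add)
  have scale: "emb j (mat_scale c m) = mat_scale c (emb j m)" for c and m :: "('u, 'f) matrix"
    using j by (simp add: emb_def tens_scale)
  have one: "emb j (C j 1 0 0 1 0) \<in> ?T"
  proof -
    have "emb j (C j 1 0 0 1 0) = (tens n U (\<lambda>i. C i 1 0 0 1 0) :: (nat \<Rightarrow> 'u, 'f) matrix)"
      unfolding emb_def by (rule tens_cong) auto
    then show ?thesis using T_closed(4) by (simp add: mat_one_eq)
  qed
  have A: "emb j (C j 0 1 1 (-1) 1) \<in> ?T"
  proof -
    have "emb j (C j 0 1 1 (-1) 1) = (adj_mat n U {j} :: (nat \<Rightarrow> 'u, 'f) matrix)"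
      unfolding emb_def adj_mat_eq by (rule tens_cong) auto
    then show ?thesis using j by (simp add: T_gen)
  qed
  have E: "emb j (C j 1 0 0 0 0) \<in> ?T"
  proof -
    \<comment> \<open>Summing the dual idempotents over all supports that avoid \<open>j\<close>
      leaves the base projection at \<open>j\<close> and yields the identity elsewhere.\<close>
    define q where "q = {1..n} - {j}"
    have "(\<Sum>h\<in>Pow q. dual_idem n U x h) = (\<Sum>h\<in>Pow q. tens n U
        (\<lambda>i. if i \<in> q then if i \<in> h then C i 0 0 0 1 0 else C i 1 0 0 0 0 else C i 1 0 0 0 0) :: (nat \<Rightarrow> 'u, 'f) matrix)"
      unfolding dual_idem_eq by (intro sum.cong tens_cong) auto
    also have "\<dots> = tens n U (\<lambda>i. if i \<in> q then C i 0 0 0 1 0 + C i 1 0 0 0 0 else C i 1 0 0 0 0)"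
      by (rule tens_sum) (auto simp: q_def)
    also have "\<dots> = emb j (C j 1 0 0 0 0)"
      unfolding emb_def by (rule tens_cong) (auto simp: q_def cell_add)
    finally have "emb j (C j 1 0 0 0 0) = (\<Sum>h\<in>Pow q. dual_idem n U x h :: (nat \<Rightarrow> 'u, 'f) matrix)"
      by (rule sym)
    also have "\<dots> \<in> ?T"
      by (intro T_sum T_gen) (auto simp: q_def)
    finally show ?thesis .
  qed
  have E': "emb j (C j 0 0 0 1 0) \<in> ?T"
  proof -
    have "C j 0 0 0 1 0 = C j 1 0 0 1 0 + mat_scale (-1) (C j 1 0 0 0 (0 :: 'f))"
      by (simp add: cell_add cell_scale)
    then show ?thesis
      using one E by (simp only: add scale T_closed)
  qed
  have prod: "emb j (mat_mult (U j) l m) \<in> ?T" if "emb j l \<in> ?T" "emb j m \<in> ?T" for l m :: "('u, 'f) matrix"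
    using T_closed(3)[OF that] j by (simp add: emb_mult)
  have r: "emb j (C j 0 1 0 0 0) \<in> ?T" and c: "emb j (C j 0 0 1 0 0) \<in> ?T"
    using prod[OF E A] prod[OF A E] j by (simp_all add: C_mult)
  have J: "emb j (C j 0 0 0 (-1) 1) \<in> ?T"
    using prod[OF E' prod[OF A E']] j by (simp add: C_mult)
  obtain \<alpha> \<beta> \<gamma> \<delta> \<epsilon> where m: "m = C j \<alpha> \<beta> \<gamma> \<delta> \<epsilon>"
    using m by (rule local_algE)
  \<comment> \<open>The last matrix is J' - I', so the coefficient of I' has to be \<delta> +
    \<epsilon>.\<close>
  have "m = mat_scale \<alpha> (C j 1 0 0 0 0) + mat_scale \<beta> (C j 0 1 0 0 0) + mat_scale \<gamma> (C j 0 0 1 0 0) +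
      mat_scale (\<delta> + \<epsilon>) (C j 0 0 0 1 0) + mat_scale \<epsilon> (C j 0 0 0 (-1) 1)"
    by (simp add: m cell_add cell_scale)
  then show ?thesis
    using E E' r c J by (simp only: add scale T_closed)
qed

text \<open>A Kronecker product is the matrix product of its factors embedded at their own places;
  the induction multiplies in one place at a time.\<close>

lemma tens_in_T:
  fixes d :: "nat \<Rightarrow> ('u, 'f::field) matrix"
  assumes "local_family d"
  shows "tens n U d \<in> T"
proof -
  have "tens n U (\<lambda>i. if i \<in> K then d i else C i 1 0 0 1 0) \<in> T" if "finite K" "K \<subseteq> {1..n}" for K
    using that
  proof (induction K rule: finite_induct)
    case empty
    then show ?case using T_closed(4) by (simp add: mat_one_eq)
  next
    case (insert j K)
    have "emb j (d j) \<odot> tens n U (\<lambda>i. if i \<in> K then d i else C i 1 0 0 1 0) =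
      tens n U (\<lambda>i. if i \<in> insert j K then d i else C i 1 0 0 1 0)"
      unfolding emb_def T_mult
    proof (rule tens_cong)
      fix i assume i: "i \<in> {1..n}"
      then obtain \<alpha> \<beta> \<gamma> \<delta> \<epsilon> where "d i = C i \<alpha> \<beta> \<gamma> \<delta> \<epsilon>"
        using assms unfolding local_family_def by (metis local_algE)
      then show "mat_mult (U i) (((\<lambda>i. C i 1 0 0 1 0)(j := d j)) i) (if i \<in> K then d i else C i 1 0 0 1 0) =
        (if i \<in> insert j K then d i else C i 1 0 0 1 0)"
        using i insert(2) by (cases "i = j") (simp_all only: C_mult fun_upd_same fun_upd_other if_True if_False insert_iff simp_thms split: if_splits, simp_all add: C_mult)
    qed
    moreover have "emb j (d j) \<in> T"
      using insert assms by (intro emb_in_T) (auto simp: local_family_def)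
    ultimately show ?case
      using insert T_closed(3) by fastforce
  qed
  from this[of "{1..n}"] have "tens n U (\<lambda>i. if i \<in> {1..n} then d i else C i 1 0 0 1 0) \<in> T"
    by simp
  also have "tens n U (\<lambda>i. if i \<in> {1..n} then d i else C i 1 0 0 1 0) = tens n U d"
    by (rule tens_cong) auto
  finally show ?thesis .
qed


section \<open>The block idempotents\<close>

abbreviation k :: "nat \<Rightarrow> 'f::field" where "k i \<equiv> of_nat (card (U i) - 1)"

text \<open>At places of \<open>minus_part\<close> the two choices are complementary: I' - J'/k and
  the base projection plus J'/k. The remaining places carry the identity, since their local centers
  offer no further idempotent.\<close>

definition fac :: "nat set \<Rightarrow> nat \<Rightarrow> ('u, 'f::field) matrix" where
  "fac S i = (if i \<in> S then C i 0 0 0 1 (- inverse (k i))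
    else if i \<in> minus_part CHAR('f) U {1..n} then C i 1 0 0 0 (inverse (k i)) else C i 1 0 0 1 0)"

definition block :: "nat set \<Rightarrow> (nat \<Rightarrow> 'u, 'f::field) matrix" where
  "block S = tens n U (fac S)"

lemma k_nonzero: "i \<in> minus_part CHAR('f) U V \<Longrightarrow> (k i :: 'f::field) \<noteq> 0"
  by (simp add: minus_part_def of_nat_eq_0_iff_char_dvd)

lemma local_family_fac: "local_family (fac S)"
  by (auto simp: local_family_def fac_def)

lemma local_familyE:
  assumes "local_family d" "i \<in> {1..n}"
  obtains \<alpha> \<beta> \<gamma> \<delta> \<epsilon> where "d i = C i \<alpha> \<beta> \<gamma> \<delta> \<epsilon>"
  using assms unfolding local_family_def by (metis local_algE)

text \<open>The matrix I' - J'/k annihilates the base row, the base column and J' from both sides,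
  because an all-ones vector on \<open>k\<close> points has square sum \<open>k\<close>. So it is
  central in the local algebra, and so is its complement.\<close>

lemma fac_commute:
  fixes d :: "nat \<Rightarrow> ('u, 'f::field) matrix"
  assumes "S \<subseteq> minus_part CHAR('f) U {1..n}" "i \<in> {1..n}" "local_family d"
  shows "mat_mult (U i) (fac S i) (d i) = mat_mult (U i) (d i) (fac S i)"
proof -
  obtain \<alpha> \<beta> \<gamma> \<delta> \<epsilon> where d: "d i = C i \<alpha> \<beta> \<gamma> \<delta> \<epsilon>"
    using assms(3,2) by (rule local_familyE)
  consider "i \<in> S" "(k i :: 'f) \<noteq> 0" | "i \<notin> S" "i \<in> minus_part CHAR('f) U {1..n}" "(k i :: 'f) \<noteq> 0"
    | "i \<notin> S" "i \<notin> minus_part CHAR('f) U {1..n}"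
    using assms(1) k_nonzero by blast
  then show ?thesis
    by cases (simp_all add: d fac_def C_mult[OF assms(2)] field_simps del: One_nat_def)
qed

lemma fac_idem:
  assumes "S \<subseteq> minus_part CHAR('f) U {1..n}" "i \<in> {1..n}"
  shows "mat_mult (U i) (fac S i) (fac S i) = (fac S i :: ('u, 'f::field) matrix)"
proof -
  consider "i \<in> S" "(k i :: 'f) \<noteq> 0" | "i \<notin> S" "i \<in> minus_part CHAR('f) U {1..n}" "(k i :: 'f) \<noteq> 0"
    | "i \<notin> S" "i \<notin> minus_part CHAR('f) U {1..n}"
    using assms(1) k_nonzero by blast
  then show ?thesis
    by cases (simp_all add: fac_def C_mult[OF assms(2)] del: One_nat_def)
qed

lemma block_in_T: "block S \<in> T"
  unfolding block_def by (intro tens_in_T local_family_fac)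

lemma block_central:
  assumes "S \<subseteq> minus_part CHAR('f) U {1..n}"
  shows "block S \<in> alg_center X (T :: (nat \<Rightarrow> 'u, 'f::field) matrix set)"
proof -
  have "block S \<odot> M = M \<odot> block S" if "M \<in> T" for M :: "(nat \<Rightarrow> 'u, 'f) matrix"
  proof -
    have "M \<in> mat.span {tens n U d |d. local_family d}"
      using that T_subset_span by auto
    then show ?thesis
    proof (induction rule: mat.span_induct)
      case base
      show ?case
        by (auto simp: mat.subspace_def mat_mult_add_left mat_mult_add_right mat_mult_scale_left mat_mult_scale_right)
    next
      case (step M)
      then obtain d where d: "M = tens n U d" "local_family d" by auto
      show ?case
        unfolding d(1) block_def T_mult using assms d(2) by (intro tens_cong fac_commute)
    qed
  qed
  then show ?thesis
    by (simp add: alg_center_def block_in_T)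
qed

lemma block_idem:
  assumes "S \<subseteq> minus_part CHAR('f) U {1..n}"
  shows "block S \<odot> block S = (block S :: (nat \<Rightarrow> 'u, 'f::field) matrix)"
  unfolding block_def T_mult using assms by (intro tens_cong fac_idem)

text \<open>At a place where the two sets differ, the factors are complementary idempotents, and one
  vanishing factor kills the Kronecker product.\<close>

lemma block_orth:
  assumes "S \<subseteq> minus_part CHAR('f) U {1..n}" "S' \<subseteq> minus_part CHAR('f) U {1..n}" "S \<noteq> S'"
  shows "block S \<odot> block S' = (0 :: (nat \<Rightarrow> 'u, 'f::field) matrix)"
proof -
  obtain i where i: "i \<in> minus_part CHAR('f) U {1..n}" "i \<in> S \<longleftrightarrow> i \<notin> S'"
    using assms by blast
  then have "i \<in> {1..n}" by (auto simp: minus_part_def)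
  moreover from this have "mat_mult (U i) (fac S i) (fac S' i) = (0 :: ('u, 'f) matrix)"
    using i k_nonzero[OF i(1)] by (cases "i \<in> S") (simp_all add: fac_def C_mult C_zero del: One_nat_def)
  ultimately show ?thesis
    unfolding block_def T_mult by (rule tens_eq_0)
qed

text \<open>This expands the identity, written at each place of \<open>minus_part\<close> as the sum
  of the two complementary idempotents.\<close>

lemma block_total:
  "(\<Sum>S\<in>Pow (minus_part CHAR('f) U {1..n}). block S) = (mat_one X :: (nat \<Rightarrow> 'u, 'f::field) matrix)"
proof -
  let ?N = "minus_part CHAR('f) U {1..n}"
  have "(\<Sum>S\<in>Pow ?N. block S) = (\<Sum>S\<in>Pow ?N. tens n U (\<lambda>i. if i \<in> ?N then if i \<in> S
      then C i 0 0 0 1 (- inverse (k i)) else C i 1 0 0 0 (inverse (k i)) else C i 1 0 0 1 (0 :: 'f)))"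
    unfolding block_def by (intro sum.cong refl tens_cong) (auto simp: fac_def)
  also have "\<dots> = tens n U (\<lambda>i. if i \<in> ?N then C i 0 0 0 1 (- inverse (k i)) + C i 1 0 0 0 (inverse (k i))
      else C i 1 0 0 1 0)"
    by (rule tens_sum) (auto simp: minus_part_def)
  also have "\<dots> = mat_one X"
    unfolding mat_one_eq by (rule tens_cong) (simp add: cell_add)
  finally show ?thesis .
qed

lemma block_nonzero:
  assumes "S \<subseteq> minus_part CHAR('f) U {1..n}"
  shows "block S \<noteq> (0 :: (nat \<Rightarrow> 'u, 'f::field) matrix)"
proof -
  have "\<exists>u v. u \<in> U i \<and> v \<in> U i \<and> (fac S i u v :: 'f) \<noteq> 0" if i: "i \<in> {1..n}" for i
  proof (cases "i \<in> S")
    case True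
    then have i': "i \<in> minus_part CHAR('f) U {1..n}" using assms by auto
    then have "card (U i) \<ge> 3"
      using card_U[OF i] by (auto simp: minus_part_def)
    \<comment> \<open>Two distinct points off the base are needed, since the diagonal entry 1 - 1/k
      may vanish in the field while the off-diagonal entry -1/k does not.\<close>
    then have "card (U i - {x i}) \<ge> 2"
      using finite_U[OF i] xU[OF i] by simp
    then obtain W where "W \<subseteq> U i - {x i}" "card W = 2"
      by (metis obtain_subset_with_card_n)
    then obtain u v where "{u, v} \<subseteq> U i - {x i}" "u \<noteq> v"
      by (auto simp: card_2_iff)
    then have "u \<in> U i \<and> v \<in> U i \<and> (fac S i u v :: 'f) \<noteq> 0"
      using True k_nonzero[OF i'] by (auto simp: fac_def cell_def)
    then show ?thesis by blast
  next
    case False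
    then have "(fac S i (x i) (x i) :: 'f) \<noteq> 0"
      using xU[OF i] by (auto simp: fac_def cell_def)
    then show ?thesis using xU[OF i] by blast
  qed
  then obtain u v where uv: "u i \<in> U i" "v i \<in> U i" "(fac S i (u i) (v i) :: 'f) \<noteq> 0" if "i \<in> {1..n}" for i
    by metis
  have "(block S (restrict u {1..n}) (restrict v {1..n}) :: 'f) = (\<Prod>i\<in>{1..n}. fac S i (u i) (v i))"
    using uv unfolding block_def tens_def XX_def by auto
  then have "(block S (restrict u {1..n}) (restrict v {1..n}) :: 'f) \<noteq> 0"
    using uv(3) by (simp del: One_nat_def)
  then show ?thesis by (metis zero_fun_apply)
qed

section \<open>Indecomposability of the block idempotents\<close>

lemma span_scalar:
  fixes M :: "(nat \<Rightarrow> 'u, 'f::field) matrix"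
  assumes M: "M \<in> T" and S: "S \<subseteq> minus_part CHAR('f) U {1..n}"
  shows "\<exists>c. dual_idem n U x S \<odot> M \<odot> dual_idem n U x S \<odot> block S =
    mat_scale c (dual_idem n U x S \<odot> block S)"
proof -
  let ?E = "dual_idem n U x S"
  have "M \<in> mat.span {tens n U d |d. local_family d}"
    using M T_subset_span by auto
  then show ?thesis
  proof (induction rule: mat.span_induct)
    case base
    show ?case
      unfolding mat.subspace_def
    proof (intro conjI allI ballI impI CollectI)
      show "\<exists>c. ?E \<odot> 0 \<odot> ?E \<odot> block S = mat_scale c (?E \<odot> block S)"
        by (rule exI[of _ 0]) (simp add: mat_scale_def fun_eq_iff)
    next
      fix M N :: "(nat \<Rightarrow> 'u, 'f) matrix"
      assume "M \<in> {M. \<exists>c. ?E \<odot> M \<odot> ?E \<odot> block S = mat_scale c (?E \<odot> block S)}"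
        "N \<in> {M. \<exists>c. ?E \<odot> M \<odot> ?E \<odot> block S = mat_scale c (?E \<odot> block S)}"
      then obtain c d where "?E \<odot> M \<odot> ?E \<odot> block S = mat_scale c (?E \<odot> block S)"
        "?E \<odot> N \<odot> ?E \<odot> block S = mat_scale d (?E \<odot> block S)"
        by blast
      then show "\<exists>c. ?E \<odot> (M + N) \<odot> ?E \<odot> block S = mat_scale c (?E \<odot> block S)"
        by (intro exI[of _ "c + d"]) (simp add: mat_mult_add_left mat_mult_add_right mat.scale_left_distrib)
    next
      fix b and M :: "(nat \<Rightarrow> 'u, 'f) matrix"
      assume "M \<in> {M. \<exists>c. ?E \<odot> M \<odot> ?E \<odot> block S = mat_scale c (?E \<odot> block S)}"
      then obtain c where "?E \<odot> M \<odot> ?E \<odot> block S = mat_scale c (?E \<odot> block S)"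
        by blast
      then show "\<exists>c. ?E \<odot> (mat_scale b M) \<odot> ?E \<odot> block S = mat_scale c (?E \<odot> block S)"
        by (intro exI[of _ "b * c"]) (simp add: mat_mult_scale_left mat_mult_scale_right)
    qed
  next
    case (step M)
    then obtain d where d: "M = tens n U d" "local_family d" by auto
    let ?e = "\<lambda>i. if i \<in> S then C i 0 0 0 1 0 else C i 1 0 0 0 (0 :: 'f)"
    \<comment> \<open>On \<open>S\<close>, compression by I' leaves \<delta> I' + \<epsilon> J', and
      the factor I' - J'/k kills J', so the scalar is \<delta>. Off \<open>S\<close>, the base
      projection leaves only \<alpha>.\<close>
    have "\<exists>c. mat_mult (U i) (mat_mult (U i) (mat_mult (U i) (?e i) (d i)) (?e i)) (fac S i) =
        mat_scale c (mat_mult (U i) (?e i) (fac S i))" if i: "i \<in> {1..n}" for i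
    proof -
      obtain \<alpha> \<beta> \<gamma> \<delta> \<epsilon> where di: "d i = C i \<alpha> \<beta> \<gamma> \<delta> \<epsilon>"
        using d(2) i by (rule local_familyE)
      consider "i \<in> S" "(k i :: 'f) \<noteq> 0" | "i \<notin> S"
        using S k_nonzero by blast
      then show ?thesis
      proof cases
        case 1
        then show ?thesis
          by (intro exI[of _ \<delta>]) (simp add: di fac_def C_mult[OF i] cell_scale field_simps del: One_nat_def)
      next
        case 2
        then show ?thesis
          by (intro exI[of _ \<alpha>]) (simp add: di fac_def C_mult[OF i] cell_scale del: One_nat_def)
      qed
    qed
    then obtain c where c: "mat_mult (U i) (mat_mult (U i) (mat_mult (U i) (?e i) (d i)) (?e i)) (fac S i) =
        mat_scale (c i) (mat_mult (U i) (?e i) (fac S i))" if "i \<in> {1..n}" for i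
      by metis
    have "?E \<odot> M \<odot> ?E \<odot> block S = tens n U (\<lambda>i. mat_scale (c i) (mat_mult (U i) (?e i) (fac S i)))"
      unfolding d(1) dual_idem_eq block_def T_mult by (rule tens_cong) (rule c)
    also have "\<dots> = mat_scale (\<Prod>i\<in>{1..n}. c i) (?E \<odot> block S)"
      unfolding dual_idem_eq block_def T_mult by (rule tens_scale_all)
    finally show ?case by blast
  qed
qed

lemma one_C_mult:
  assumes "i \<in> {1..n}" "local_family d"
  shows "mat_mult (U i) (C i 1 0 0 1 0) (d i) = d i" "mat_mult (U i) (d i) (C i 1 0 0 1 0) = d i"
proof -
  obtain \<alpha> \<beta> \<gamma> \<delta> \<epsilon> where "d i = C i \<alpha> \<beta> \<gamma> \<delta> \<epsilon>"
    using assms(2,1) by (rule local_familyE)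
  then show "mat_mult (U i) (C i 1 0 0 1 0) (d i) = d i" "mat_mult (U i) (d i) (C i 1 0 0 1 0) = d i"
    by (simp_all add: C_mult[OF assms(1)])
qed

lemma emb_tens:
  assumes "local_family d"
  shows "emb j m \<odot> tens n U d = tens n U (d(j := mat_mult (U j) m (d j)))"
    and "tens n U d \<odot> emb j m = tens n U (d(j := mat_mult (U j) (d j) m))"
  unfolding emb_def T_mult using one_C_mult[OF _ assms] by (auto intro!: tens_cong)

text \<open>Undoes right multiplication of \<open>I'\<close> by the base column at place \<open>j\<close>; not an operation inside \<open>T\<close>.\<close>

definition unfold_col :: "nat \<Rightarrow> (nat \<Rightarrow> 'u, 'f::field) matrix \<Rightarrow> (nat \<Rightarrow> 'u, 'f) matrix" where
  "unfold_col j M = (\<lambda>y z. if y \<in> X \<and> z \<in> X \<and> y j = z j \<and> y j \<noteq> x j then M y (z(j := x j)) else 0)"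

lemma unfold_col_tens:
  assumes j: "j \<in> {1..n}"
  shows "unfold_col j (tens n U (d(j := C j 0 0 \<delta> 0 0))) = tens n U (d(j := C j 0 0 0 \<delta> 0))"
proof (intro ext)
  fix y z
  show "unfold_col j (tens n U (d(j := C j 0 0 \<delta> 0 0))) y z = tens n U (d(j := C j 0 0 0 \<delta> 0)) y z"
  proof (cases "y \<in> X \<and> z \<in> X")
    case True
    then have "z(j := x j) \<in> X" "y j \<in> U j" "z j \<in> U j"
      using j xU[OF j] unfolding XX_def by (auto simp: PiE_def extensional_def)
    moreover have "(\<Prod>i\<in>{1..n} - {j}. d i (y i) ((z(j := x j)) i)) = (\<Prod>i\<in>{1..n} - {j}. d i (y i) (z i))"
      by (rule prod.cong) auto
    ultimately show ?thesis
      using True xU[OF j] unfolding unfold_col_def tens_split[OF j] by (auto simp: cell_def)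
  next
    case False
    then show ?thesis by (auto simp: unfold_col_def tens_def)
  qed
qed

text \<open>On a Kronecker product, compression by I' leaves \<delta> I' + \<epsilon> J' at
  \<open>j\<close>, while for k = 0 multiplication by the base column retains only \<delta>. So
  \<open>Fc\<close> removes the I' part, and J' J' = k J' = 0. The linear map
  \<open>unfold_col\<close> does this without comparing coefficients in a spanning set that need not
  be independent.\<close>

lemma nilpotent_part:
  fixes F :: "(nat \<Rightarrow> 'u, 'f::field) matrix"
  assumes j: "j \<in> {1..n}" and k0: "(k j :: 'f) = 0" and F: "F \<in> T"
    and FE: "emb j (C j 0 0 0 1 0) \<odot> F \<odot> emb j (C j 0 0 0 1 0) = F"
    and Fc: "F \<odot> emb j (C j 0 0 1 0 0) = 0"
  shows "F \<odot> F = 0"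
proof -
  let ?V = "{tens n U d |d. \<exists>e :: 'f. d j = C j 0 0 0 0 e}"
  have "F \<in> mat.span {tens n U d |d. local_family d}"
    using F T_subset_span by auto
  then have "emb j (C j 0 0 0 1 0) \<odot> F \<odot> emb j (C j 0 0 0 1 0) -
      unfold_col j (F \<odot> emb j (C j 0 0 1 0 0)) \<in> mat.span ?V"
  proof (induction rule: mat.span_induct)
    case base
    have *: "unfold_col j (M + N) = unfold_col j M + unfold_col j N"
      "unfold_col j (mat_scale c M) = mat_scale c (unfold_col j M)"
      "unfold_col j 0 = 0" for M N :: "(nat \<Rightarrow> 'u, 'f) matrix" and c
      by (auto simp: unfold_col_def fun_eq_iff mat_scale_def)
    have **: "a + b - (c + d) = (a - c) + (b - d)" for a b c d :: "(nat \<Rightarrow> 'u, 'f) matrix"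
      by (simp add: algebra_simps)
    show ?case
      unfolding mat.subspace_def
    proof (intro conjI allI ballI impI CollectI)
      show "emb j (C j 0 0 0 1 0) \<odot> 0 \<odot> emb j (C j 0 0 0 1 0) -
          unfold_col j (0 \<odot> emb j (C j 0 0 1 0 0)) \<in> mat.span ?V"
        by (simp only: mat_mult_0_left mat_mult_0_right * diff_self mat.span_zero)
    qed (auto simp only: mem_Collect_eq mat_mult_add_left mat_mult_add_right mat_mult_scale_left
        mat_mult_scale_right * ** mat.scale_right_diff_distrib[symmetric] intro: mat.span_add mat.span_scale)
  next
    case (step F)
    then obtain d where d: "F = tens n U d" "local_family d" by auto
    obtain \<alpha> \<beta> \<gamma> \<delta> \<epsilon> where dj: "d j = C j \<alpha> \<beta> \<gamma> \<delta> \<epsilon>"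
      using d(2) j by (rule local_familyE)
    have "emb j (C j 0 0 0 1 0) \<odot> F \<odot> emb j (C j 0 0 0 1 0) = tens n U (d(j := C j 0 0 0 \<delta> \<epsilon>))"
    proof -
      have "local_family (d(j := mat_mult (U j) (C j 0 0 0 1 0) (d j)))"
        using d(2) j unfolding local_family_def by (auto intro: local_alg_mult)
      then show ?thesis
        by (simp add: d emb_tens dj C_mult[OF j])
    qed
    also have "tens n U (d(j := C j 0 0 0 \<delta> \<epsilon>)) =
        tens n U (d(j := C j 0 0 0 \<delta> 0)) + tens n U (d(j := C j 0 0 0 0 \<epsilon>))"
      using j by (simp add: cell_add flip: tens_add)
    finally have 1: "emb j (C j 0 0 0 1 0) \<odot> F \<odot> emb j (C j 0 0 0 1 0) =
        tens n U (d(j := C j 0 0 0 \<delta> 0)) + tens n U (d(j := C j 0 0 0 0 \<epsilon>))" .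
    have "F \<odot> emb j (C j 0 0 1 0 0) = tens n U (d(j := C j 0 0 \<delta> 0 0))"
      using k0 by (simp add: d emb_tens dj C_mult[OF j] del: One_nat_def)
    then have 2: "unfold_col j (F \<odot> emb j (C j 0 0 1 0 0)) = tens n U (d(j := C j 0 0 0 \<delta> 0))"
      using j by (simp add: unfold_col_tens)
    have "tens n U (d(j := C j 0 0 0 0 \<epsilon>)) \<in> mat.span ?V"
      by (rule mat.span_base, rule CollectI, rule exI, rule conjI, rule refl, rule exI, rule fun_upd_same)
    then show ?case
      unfolding 1 2 by (simp only: add_diff_cancel_left')
  qed
  moreover have "unfold_col j 0 = (0 :: (nat \<Rightarrow> 'u, 'f) matrix)"
    by (auto simp: unfold_col_def fun_eq_iff)
  \<comment> \<open>By \<open>FE\<close> and \<open>Fc\<close> the difference just treated is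
    \<open>F\<close> itself.\<close>
  ultimately have FV: "F \<in> mat.span ?V"
    by (simp only: FE Fc diff_zero)
  have "F \<odot> F \<in> {0}"
  proof (rule span_mat_mult[OF _ _ FV FV])
    show "mat.subspace {0 :: (nat \<Rightarrow> 'u, 'f) matrix}"
      by (rule mat.subspace_single_0)
    fix M N assume "M \<in> ?V" "N \<in> ?V"
    then obtain d d' e e' where d: "M = tens n U d" "N = tens n U d'" "d j = C j 0 0 0 0 e" "d' j = C j 0 0 0 0 e'"
      by auto
    have "M \<odot> N = 0"
      unfolding d(1,2) T_mult using j by (rule tens_eq_0) (simp add: d(3,4) C_mult[OF j] k0 C_zero del: One_nat_def)
    then show "M \<odot> N \<in> {0}" by simp
  qed
  then show ?thesis by simp
qed

lemma block_absorb_zero: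
  fixes f :: "(nat \<Rightarrow> 'u, 'f::field) matrix"
  assumes S: "S \<subseteq> minus_part CHAR('f) U {1..n}"
    and f: "f \<in> alg_center X T" "f \<odot> f = f" "f \<odot> block S = f"
    and f0: "f \<odot> dual_idem n U x S = 0"
  shows "f = 0"
proof -
  let ?one = "1 :: 'f"
  have fT: "f \<in> T" and comm: "f \<odot> M = M \<odot> f" if "M \<in> T" for M
    using alg_centerD[OF f(1)] that by auto
  \<comment> \<open>The set \<open>K\<close> contains the released places, which carry the identity
    instead of the base projection. For \<open>K = {}\<close> this gives the dual idempotent of
    \<open>S\<close>, on which \<open>f\<close> vanishes by assumption.\<close>
  define g where "g K = (\<lambda>i. if i \<in> S then C i 0 0 0 ?one 0 else if i \<in> K then C i 1 0 0 1 0 else C i 1 0 0 0 0)" for K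
  have local_family_g: "local_family (g K)" for K
    by (simp add: local_family_def g_def)
  have local_family_upd: "local_family ((g K)(j := C j \<alpha> \<beta> \<gamma> \<delta> \<epsilon>))" for K j \<alpha> \<beta> \<gamma> \<delta> \<epsilon>
    by (simp add: local_family_def g_def)
  have "f \<odot> tens n U (g K) = 0" if "finite K" "K \<subseteq> {1..n} - S" for K
    using that
  proof (induction K rule: finite_induct)
    case empty
    have "tens n U (g {}) = dual_idem n U x S"
      unfolding dual_idem_eq by (rule tens_cong) (simp add: g_def)
    then show ?case using f0 by simp
  next
    case (insert j K)
    then have j: "j \<in> {1..n}" "j \<notin> S" "j \<notin> K" and "K \<subseteq> {1..n} - S"
      by auto
    from this(4) have IH: "f \<odot> tens n U (g K) = 0"
      by (rule insert.IH)
    have gj: "g K j = C j 1 0 0 0 0" using j by (simp add: g_def)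
    \<comment> \<open>Releasing \<open>j\<close> adds to the diagonal part exactly \<open>P\<close>,
      which carries I' at this place.\<close>
    define P where "P = tens n U ((g K)(j := C j 0 0 0 ?one 0))"
    have PT: "P \<in> T" unfolding P_def by (intro tens_in_T local_family_upd)
    have "g (insert j K) = (g K)(j := C j 0 0 0 1 0 + C j 1 0 0 0 0)"
      using j by (auto simp: g_def fun_eq_iff cell_add)
    moreover have "(g K)(j := C j 1 0 0 0 0) = g K"
      using gj by (metis fun_upd_triv)
    ultimately have split: "tens n U (g (insert j K)) = P + tens n U (g K)"
      using tens_add[OF j(1), of U "g K" "C j 0 0 0 1 0" "C j 1 0 0 0 0"] unfolding P_def by metis
    have "f \<odot> P = 0"
    proof (cases "(k j :: 'f) = 0")
      case False
      \<comment> \<open>J'/k is a column times a row through the base point, so this matrix lies in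
        the ideal generated by the old diagonal part. Against \<open>block S\<close> it agrees with
        \<open>P\<close>: the factor at \<open>j\<close> absorbs the difference of I' and J'/k, or
        \<open>U j\<close> has two points and I' = J' with k = 1.\<close>
      have "emb j (C j 0 0 (inverse (k j)) 0 0) \<odot> tens n U (g K) \<odot> emb j (C j 0 1 0 0 0) =
          tens n U ((g K)(j := C j 0 0 0 0 (inverse (k j))))"
        using gj by (simp add: emb_tens local_family_g local_family_upd C_mult[OF j(1)] del: One_nat_def)
      moreover have "tens n U ((g K)(j := C j 0 0 0 0 (inverse (k j)))) \<odot> block S = P \<odot> block S"
        unfolding block_def P_def T_mult
      proof (rule tens_cong)
        fix i assume i: "i \<in> {1..n}"
        have "mat_mult (U j) (C j 0 0 0 0 (inverse (k j))) (fac S j) = mat_mult (U j) (C j 0 0 0 1 0) (fac S j :: ('u, 'f) matrix)"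
        proof (cases "j \<in> minus_part CHAR('f) U {1..n}")
          case True
          then show ?thesis
            using j(2) \<open>(k j :: 'f) \<noteq> 0\<close> by (simp add: fac_def C_mult[OF j(1)] del: One_nat_def)
        next
          case F: False
          then have c2: "card (U j) = 2"
            using j(1) False by (auto simp: minus_part_def of_nat_eq_0_iff_char_dvd)
          then have "C j 0 0 0 0 ?one = C j 0 0 0 1 0"
            using cell_card_2[OF c2 xU[OF j(1)], of 0 0 0 0 ?one] by simp
          then show ?thesis
            using c2 by simp
        qed
        then show "mat_mult (U i) (((g K)(j := C j 0 0 0 0 (inverse (k j)))) i) (fac S i) =
            mat_mult (U i) (((g K)(j := C j 0 0 0 1 0)) i) (fac S i)"
          by simp
      qed
      ultimately have P: "P \<odot> block S = emb j (C j 0 0 (inverse (k j)) 0 0) \<odot> tens n U (g K) \<odot> emb j (C j 0 1 0 0 0) \<odot> block S"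
        by simp
      have "f \<odot> P = f \<odot> (block S \<odot> P)"
        using f(3) by (metis mat_mult_assoc)
      also have "block S \<odot> P = P \<odot> block S"
        using alg_centerD(2)[OF block_central[OF S] PT] .
      also have "f \<odot> (P \<odot> block S) = f \<odot> emb j (C j 0 0 (inverse (k j)) 0 0) \<odot> (tens n U (g K) \<odot> emb j (C j 0 1 0 0 0) \<odot> block S)"
        by (simp only: P mat_mult_assoc)
      also have "f \<odot> emb j (C j 0 0 (inverse (k j)) 0 0) = emb j (C j 0 0 (inverse (k j)) 0 0) \<odot> f"
        by (intro comm emb_in_T j local_algI)
      also have "\<dots> \<odot> (tens n U (g K) \<odot> emb j (C j 0 1 0 0 0) \<odot> block S) =
          emb j (C j 0 0 (inverse (k j)) 0 0) \<odot> (f \<odot> tens n U (g K)) \<odot> emb j (C j 0 1 0 0 0) \<odot> block S"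
        by (simp only: mat_mult_assoc)
      finally show ?thesis by (simp add: IH)
    next
      case True
      let ?I = "emb j (C j 0 0 0 ?one 0)" and ?c = "emb j (C j 0 0 ?one 0 0)"
      have IT: "?I \<in> T" and cT: "?c \<in> T"
        by (intro emb_in_T j local_algI)+
      have 1: "?I \<odot> P = P" "P \<odot> ?I = P"
        unfolding P_def by (simp_all add: emb_tens local_family_upd C_mult[OF j(1)])
      have 2: "P \<odot> P = P"
        unfolding P_def T_mult by (rule tens_cong) (auto simp: g_def C_mult)
      have 3: "P \<odot> ?c = ?c \<odot> tens n U (g K)"
        unfolding P_def by (simp add: emb_tens local_family_upd local_family_g gj C_mult[OF j(1)])
      have "?I \<odot> (f \<odot> P) \<odot> ?I = f \<odot> (?I \<odot> P \<odot> ?I)"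
        by (simp only: comm[OF IT, symmetric] flip: mat_mult_assoc)
      then have 4: "?I \<odot> (f \<odot> P) \<odot> ?I = f \<odot> P"
        by (simp only: 1)
      \<comment> \<open>The base column at \<open>j\<close> leads from \<open>P\<close> back to the
        old diagonal part, where \<open>f\<close> is already known to vanish.\<close>
      have "(f \<odot> P) \<odot> ?c = f \<odot> ?c \<odot> tens n U (g K)"
        by (simp only: 3 mat_mult_assoc)
      also have "\<dots> = ?c \<odot> (f \<odot> tens n U (g K))"
        by (simp only: comm[OF cT] mat_mult_assoc)
      finally have 5: "(f \<odot> P) \<odot> ?c = 0"
        by (simp add: IH)
      have "f \<odot> P \<in> T"
        using fT[OF PT] PT by (rule T_closed(3))
      then have "(f \<odot> P) \<odot> (f \<odot> P) = 0"
        using nilpotent_part[OF j(1) True _ 4 5] by simp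
      \<comment> \<open>Since \<open>f\<close> is central and both factors are idempotent, the
        square of their product is the product itself.\<close>
      moreover have "(f \<odot> P) \<odot> (f \<odot> P) = f \<odot> (P \<odot> f) \<odot> P"
        by (simp only: mat_mult_assoc)
      moreover have "\<dots> = (f \<odot> f) \<odot> (P \<odot> P)"
        by (simp only: comm[OF PT, symmetric] mat_mult_assoc)
      ultimately show ?thesis
        by (simp only: f(2) 2)
    qed
    then show ?case
      by (simp only: split mat_mult_add_right IH add_0)
  qed
  from this[of "{1..n} - S"] have "f \<odot> tens n U (g ({1..n} - S)) = 0"
    by simp
  \<comment> \<open>With every place outside \<open>S\<close> released, only I' on \<open>S\<close>
    is left, and the factors of \<open>block S\<close> there live off the base point.\<close>
  moreover have "tens n U (g ({1..n} - S)) \<odot> block S = block S"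
    unfolding block_def T_mult
  proof (rule tens_cong)
    fix i assume i: "i \<in> {1..n}"
    show "mat_mult (U i) (g ({1..n} - S) i) (fac S i) = fac S i"
    proof (cases "i \<in> S")
      case True
      then show ?thesis by (simp add: g_def fac_def C_mult[OF i])
    next
      case False
      then have "g ({1..n} - S) i = C i 1 0 0 1 0"
        using i by (simp add: g_def)
      then show ?thesis using one_C_mult(1)[OF i local_family_fac] by simp
    qed
  qed
  ultimately show ?thesis
    using f(3) by (metis mat_mult_assoc mat_mult_0_left)
qed

text \<open>Let E be the dual idempotent of \<open>S\<close>. By \<open>span_scalar\<close>,
  \<open>f\<close> and its complement \<open>f'\<close> in \<open>block S\<close> act on E as
  multiples \<open>c\<close> and \<open>1 - c\<close> of the same matrix. Since
  \<open>f f' = 0\<close>, one of them kills E, and \<open>block_absorb_zero\<close> makes it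
  zero.\<close>

lemma block_indecomposable:
  fixes f :: "(nat \<Rightarrow> 'u, 'f::field) matrix"
  assumes S: "S \<subseteq> minus_part CHAR('f) U {1..n}"
    and f: "f \<in> alg_center X T" "f \<odot> f = f" "f \<odot> block S = f"
  shows "f = 0 \<or> f = block S"
proof -
  let ?E = "dual_idem n U x S :: (nat \<Rightarrow> 'u, 'f) matrix"
  define f' where "f' = block S - f"
  have bc: "block S \<in> alg_center X (T :: (nat \<Rightarrow> 'u, 'f) matrix set)"
    using S by (rule block_central)
  have fT: "f \<in> T" by (rule alg_centerD(1)[OF f(1)])
  have ET: "?E \<in> T" using S by (intro T_gen) (auto simp: minus_part_def)
  have EE: "?E \<odot> ?E = ?E"
    unfolding dual_idem_eq T_mult by (rule tens_cong) (simp add: C_mult)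
  have bf: "block S \<odot> f = f"
    using alg_centerD(2)[OF f(1) block_in_T[of S]] f(3) by simp
  have f': "f' \<in> alg_center X T" "f' \<odot> f' = f'" "f' \<odot> block S = f'" "f \<odot> f' = 0"
    using f(2,3) bf block_idem[OF S] alg_center_diff[OF T_subalgebra bc f(1)]
    by (simp_all add: f'_def mat_mult_diff_left mat_mult_diff_right)
  have fE: "f \<odot> ?E = ?E \<odot> f"
    by (rule alg_centerD(2)[OF f(1) ET])
  obtain c where c: "?E \<odot> f \<odot> ?E \<odot> block S = mat_scale c (?E \<odot> block S)"
    using span_scalar[OF fT S] by auto
  have bE: "block S \<odot> ?E = ?E \<odot> block S"
    by (rule alg_centerD(2)[OF bc ET])
  \<comment> \<open>Both \<open>f\<close> and \<open>block S\<close> commute with E, so the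
    two-sided compression collapses to \<open>f E\<close>.\<close>
  have "?E \<odot> f \<odot> ?E \<odot> block S = ?E \<odot> f \<odot> (block S \<odot> ?E)"
    by (simp only: mat_mult_assoc bE)
  also have "\<dots> = ?E \<odot> (f \<odot> block S) \<odot> ?E"
    by (simp only: mat_mult_assoc)
  also have "\<dots> = f \<odot> ?E"
    by (simp only: f(3) fE[symmetric]) (simp only: mat_mult_assoc EE)
  finally have 1: "f \<odot> ?E = mat_scale c (?E \<odot> block S)"
    using c by simp
  then have 2: "f' \<odot> ?E = mat_scale (1 - c) (?E \<odot> block S)"
    by (simp add: f'_def mat_mult_diff_left bE mat_scale_def fun_eq_iff algebra_simps)
  have "f \<odot> (f' \<odot> ?E) = 0"
    using f'(4) by (metis mat_mult_assoc mat_mult_0_left)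
  also have "f \<odot> (f' \<odot> ?E) = mat_scale (1 - c) (f \<odot> ?E \<odot> block S)"
    by (simp only: 2 mat_mult_scale_right mat_mult_assoc)
  also have "f \<odot> ?E \<odot> block S = mat_scale c (?E \<odot> (block S \<odot> block S))"
    by (simp only: 1 mat_mult_scale_left mat_mult_assoc)
  finally have "mat_scale (1 - c) (mat_scale c (?E \<odot> block S)) = 0"
    by (simp only: block_idem[OF S])
  then have "mat_scale c (?E \<odot> block S) = 0 \<or> mat_scale (1 - c) (?E \<odot> block S) = 0"
    by (metis mat.scale_eq_0_iff)
  then have "f \<odot> ?E = 0 \<or> f' \<odot> ?E = 0"
    unfolding 1 2 .
  then have "f = 0 \<or> f' = 0"
    using block_absorb_zero[OF S f] block_absorb_zero[OF S f'(1-3)] by blast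
  then show ?thesis
    by (auto simp: f'_def)
qed

end


section \<open>The elements \<open>D\<^sub>m\<close> as Kronecker products\<close>

text \<open>For \<open>b\<close> inside \<open>minus_part p U a\<close>, the equation
  \<open>minus_part p U a - b = S\<close> determines \<open>b\<close> as the complement of
  \<open>S\<close>, so \<open>a\<close> alone parametrizes a class.\<close>

definition block_class :: "nat \<Rightarrow> nat \<Rightarrow> (nat \<Rightarrow> 'u set) \<Rightarrow> nat set \<Rightarrow> (nat set \<times> nat set \<times> nat set) set" where
  "block_class p n U S = (\<lambda>a. (a, minus_part p U a - S, a)) ` {a. S \<subseteq> a \<and> a \<subseteq> {1..n}}"

context factorial_scheme
begin

lemma minus_part_eq: "a \<subseteq> {1..n} \<Longrightarrow> minus_part p U a = a \<inter> minus_part p U {1..n}"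
  by (auto simp: minus_part_def)

text \<open>Divisibility is read off in the field, which treats all characteristics alike: a product
  vanishes only if one of its factors does.\<close>

lemma valency_dvd_iff:
  assumes "b \<subseteq> circ_part U {1..n}"
  shows "\<not> CHAR('f::field) dvd valency U b \<longleftrightarrow> b \<subseteq> minus_part CHAR('f) U {1..n}"
proof -
  have "\<not> CHAR('f) dvd valency U b \<longleftrightarrow> (of_nat (valency U b) :: 'f) \<noteq> 0"
    by (simp add: of_nat_eq_0_iff_char_dvd)
  also have "\<dots> \<longleftrightarrow> (\<forall>i\<in>b. (k i :: 'f) \<noteq> 0)"
  proof -
    have "finite b"
      using assms by (rule finite_subset) (simp add: circ_part_def)
    then show ?thesis by (simp add: valency_def)
  qed
  also have "\<dots> \<longleftrightarrow> b \<subseteq> minus_part CHAR('f) U {1..n}"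
    using assms by (auto simp: minus_part_def circ_part_def of_nat_eq_0_iff_char_dvd)
  finally show ?thesis .
qed

lemma diag_triples_iff:
  "(a, b, c) \<in> diag_triples CHAR('f::field) n U \<longleftrightarrow>
    c = a \<and> a \<subseteq> {1..n} \<and> b \<subseteq> minus_part CHAR('f) U a"
proof (cases "c = a \<and> a \<subseteq> {1..n} \<and> b \<subseteq> circ_part U a")
  case True
  then have "b \<subseteq> circ_part U {1..n}" "b \<subseteq> a" by (auto simp: circ_part_def)
  then show ?thesis
    using True valency_dvd_iff[of b, where 'f = 'f] minus_part_eq[of a "CHAR('f)"]
    by (auto simp: diag_triples_def PP_def EE_def)
next
  case False
  then show ?thesis
    by (auto simp: diag_triples_def PP_def EE_def minus_part_def circ_part_def)
qed

lemma bij_betw_block_class: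
  "bij_betw (block_class CHAR('f::field) n U) (Pow (minus_part CHAR('f) U {1..n})) (diag_classes CHAR('f) n U)"
proof -
  let ?p = "CHAR('f)"
  let ?N = "minus_part ?p U {1..n}"
  have cls: "block_class ?p n U (minus_part ?p U a - b) = diag_equiv ?p n U `` {(a, b, c)}"
    if t: "(a, b, c) \<in> diag_triples ?p n U" for a b c
  proof -
    have "(a', b', c') \<in> block_class ?p n U (minus_part ?p U a - b) \<longleftrightarrow>
      (a', b', c') \<in> diag_triples ?p n U \<and> minus_part ?p U a - b = minus_part ?p U a' - b'" for a' b' c'
    proof -
      have "minus_part ?p U a \<subseteq> ?N"
        using t unfolding diag_triples_iff by (auto simp: minus_part_def)
      then have "minus_part ?p U a - b \<subseteq> a' \<and> a' \<subseteq> {1..n} \<and> b' = minus_part ?p U a' - (minus_part ?p U a - b) \<longleftrightarrow>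
        a' \<subseteq> {1..n} \<and> b' \<subseteq> minus_part ?p U a' \<and> minus_part ?p U a - b = minus_part ?p U a' - b'"
        by (auto simp: minus_part_def)
      then show ?thesis
        unfolding diag_triples_iff block_class_def by auto
    qed
    then show ?thesis
      using t by (auto simp: diag_equiv_def)
  qed
  have rep: "(S, {}, S) \<in> diag_triples ?p n U" "minus_part ?p U S = S" if "S \<subseteq> ?N" for S
    using that unfolding diag_triples_iff by (auto simp: minus_part_def)
  have "inj_on (block_class ?p n U) (Pow ?N)"
  proof (rule inj_onI)
    fix S S' assume S: "S \<in> Pow ?N" "S' \<in> Pow ?N" "block_class ?p n U S = block_class ?p n U S'"
    \<comment> \<open>Membership of \<open>(S, {}, S)\<close> in the class of \<open>S'\<close> will
      force \<open>S'\<close> to be a subset of \<open>S\<close>, and symmetrically.\<close>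
    have "(S, {}, S) \<in> block_class ?p n U S" "(S', {}, S') \<in> block_class ?p n U S'"
      using S(1,2) rep[of S] rep[of S'] by (auto simp: block_class_def diag_triples_iff image_iff)
    then have "(S, {}, S) \<in> block_class ?p n U S'" "(S', {}, S') \<in> block_class ?p n U S"
      using S(3) by auto
    then show "S = S'"
      by (auto simp: block_class_def)
  qed
  moreover have "block_class ?p n U ` Pow ?N = diag_classes ?p n U"
  proof (intro equalityI subsetI)
    fix K assume "K \<in> block_class ?p n U ` Pow ?N"
    then obtain S where S: "S \<subseteq> ?N" "K = block_class ?p n U S" by auto
    then have "K = diag_equiv ?p n U `` {(S, {}, S)}"
      using cls[OF rep(1)[OF S(1)]] rep(2)[OF S(1)] by simp
    then show "K \<in> diag_classes ?p n U"
      unfolding diag_classes_def using rep(1)[OF S(1)] by (simp add: quotientI)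
  next
    fix K assume "K \<in> diag_classes ?p n U"
    then obtain a b c where t: "(a, b, c) \<in> diag_triples ?p n U" "K = diag_equiv ?p n U `` {(a, b, c)}"
      unfolding diag_classes_def by (auto elim!: quotientE)
    then have "K = block_class ?p n U (minus_part ?p U a - b)"
      using cls by simp
    moreover have "minus_part ?p U a - b \<subseteq> ?N"
      using t(1) unfolding diag_triples_iff by (auto simp: minus_part_def)
    ultimately show "K \<in> block_class ?p n U ` Pow ?N"
      by blast
  qed
  ultimately show ?thesis
    by (simp add: bij_betw_def)
qed

section \<open>Evaluation of the diagonal B and D, and of the class sums\<close>

lemma B_mat_diag:
  assumes "q \<subseteq> a" "a \<subseteq> {1..n}"
  shows "B_mat n U x a q a = (tens n U (\<lambda>i. if i \<in> q then C i 0 0 0 0 1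
    else if i \<in> a then C i 0 0 0 1 0 else C i 1 0 0 0 0) :: (nat \<Rightarrow> 'u, 'f::field) matrix)"
proof -
  have "dual_idem n U x a \<odot> adj_mat n U j \<odot> dual_idem n U x a =
    tens n U (\<lambda>i. if i \<in> q then if i \<in> j then C i 0 0 0 (-1) 1 else C i 0 0 0 1 0
      else if i \<in> a then C i 0 0 0 1 0 else C i 1 0 0 0 (0 :: 'f))" if "j \<subseteq> q" for j
    unfolding dual_idem_eq adj_mat_eq T_mult using that assms
    by (intro tens_cong) (auto simp: C_mult)
  moreover have "{j. sym_diff a a \<subseteq> j \<and> j \<subseteq> q} = Pow q"
    by auto
  ultimately have "B_mat n U x a q a = (\<Sum>j\<in>Pow q. tens n U (\<lambda>i. if i \<in> q then if i \<in> j then C i 0 0 0 (-1) 1 else C i 0 0 0 1 0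
      else if i \<in> a then C i 0 0 0 1 0 else C i 1 0 0 0 (0 :: 'f)))"
    unfolding B_mat_def by (intro sum.cong) auto
  \<comment> \<open>A place of \<open>q\<close> carries J' - I' if it lies in \<open>j\<close> and
    I' otherwise; the two add up to J'.\<close>
  also have "\<dots> = tens n U (\<lambda>i. if i \<in> q then C i 0 0 0 (-1) 1 + C i 0 0 0 1 0
      else if i \<in> a then C i 0 0 0 1 0 else C i 1 0 0 0 0)"
    using assms by (intro tens_sum) auto
  also have "\<dots> = tens n U (\<lambda>i. if i \<in> q then C i 0 0 0 0 1
      else if i \<in> a then C i 0 0 0 1 0 else C i 1 0 0 0 0)"
    by (rule tens_cong) (simp add: cell_add)
  finally show ?thesis .
qed

text \<open>The admissible \<open>q\<close> are the sets between \<open>b\<close> and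
  \<open>minus_part CHAR('f) U a\<close>, that is, \<open>b\<close> together with a subset of
  \<open>S\<close>. At each place of \<open>S\<close> the signed sum chooses between -J'/k and I',
  which produces I' - J'/k.\<close>

lemma D_mat_diag:
  assumes S: "S \<subseteq> minus_part CHAR('f::field) U {1..n}" and a: "S \<subseteq> a" "a \<subseteq> {1..n}"
  shows "D_mat n U x a (minus_part CHAR('f) U a - S) a =
    (tens n U (\<lambda>i. if i \<in> S then C i 0 0 0 1 (- inverse (k i))
      else if i \<in> minus_part CHAR('f) U a then C i 0 0 0 0 (inverse (k i))
      else if i \<in> a then C i 0 0 0 1 0 else C i 1 0 0 0 0) :: (nat \<Rightarrow> 'u, 'f) matrix)"
proof -
  define M where "M = minus_part CHAR('f) U a"
  define b where "b = M - S"
  have M: "M = a \<inter> minus_part CHAR('f) U {1..n}" "S \<subseteq> M" "M = b \<union> S" "M \<subseteq> a" "b \<inter> S = {}" "b \<subseteq> M"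
    using S a by (auto simp: M_def b_def minus_part_eq[OF a(2)])
  have fin: "finite {1..n}" "finite M" "finite S"
    using M(2,4) a(2) finite_subset[of M "{1..n}"] finite_subset[of S "{1..n}"] by auto
  have index: "{q. q \<in> EE n \<and> b \<subseteq> q \<and> q \<subseteq> sym_diff a a \<union> circ_part U (a \<inter> a) \<and> \<not> CHAR('f) dvd valency U q}
    = (\<lambda>j. b \<union> j) ` Pow S" (is "?Q = _")
  proof -
    have "q \<in> ?Q \<longleftrightarrow> b \<subseteq> q \<and> q \<subseteq> M" for q
    proof (cases "q \<subseteq> circ_part U a")
      case True
      then have "q \<subseteq> circ_part U {1..n}" "q \<subseteq> a" using a by (auto simp: circ_part_def)
      then show ?thesis
        using True a valency_dvd_iff[of q, where 'f = 'f] by (auto simp: EE_def M(1))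
    next
      case False
      moreover have "M \<subseteq> circ_part U a" by (auto simp: M_def minus_part_def circ_part_def)
      ultimately show ?thesis by auto
    qed
    then have "?Q = {q. b \<subseteq> q \<and> q \<subseteq> b \<union> S}"
      by (auto simp: M(3))
    also have "\<dots> = (\<lambda>j. b \<union> j) ` Pow S"
    proof (intro equalityI subsetI)
      fix q assume "q \<in> {q. b \<subseteq> q \<and> q \<subseteq> b \<union> S}"
      then show "q \<in> (\<lambda>j. b \<union> j) ` Pow S"
        by (intro image_eqI[of _ _ "q - b"]) auto
    qed auto
    finally show ?thesis .
  qed
  have inj: "inj_on (\<lambda>j. b \<union> j) (Pow S)"
    using M(5) by (intro inj_onI) blast
  have summand: "mat_scale ((- 1) ^ card (b \<union> j - b) * inverse (of_nat (valency U (a \<inter> (b \<union> j))))) (B_mat n U x a (b \<union> j) a) =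
    tens n U (\<lambda>i. if i \<in> S then if i \<in> j then C i 0 0 0 0 (- inverse (k i)) else C i 0 0 0 1 0
      else if i \<in> b then C i 0 0 0 0 (inverse (k i)) else if i \<in> a then C i 0 0 0 1 0 else C i 1 0 0 0 (0 :: 'f))"
    if j: "j \<subseteq> S" for j
  proof -
    \<comment> \<open>The sign and the inverse valency are distributed over the places, so that they
      can be absorbed into the local factors.\<close>
    define w :: "nat \<Rightarrow> 'f" where "w i = (if i \<in> j then - inverse (k i) else if i \<in> b then inverse (k i) else 1)" for i
    have jb: "b \<union> j \<subseteq> a" "b \<union> j - b = j" "a \<inter> (b \<union> j) = b \<union> j" "finite (b \<union> j)" "b \<union> j \<subseteq> {1..n}" "finite j" "b \<inter> j = {}" "finite b"
      using j M a fin by (auto intro: finite_subset)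
    have "(\<Prod>i\<in>{1..n}. w i) = (\<Prod>i\<in>b \<union> j. w i)"
      using jb fin by (intro prod.mono_neutral_right) (auto simp: w_def)
    also have "\<dots> = (\<Prod>i\<in>b. w i) * (\<Prod>i\<in>j. w i)"
      using jb by (intro prod.union_disjoint) auto
    also have "(\<Prod>i\<in>j. w i) = (\<Prod>i\<in>j. (- 1) * inverse (k i))"
      by (rule prod.cong) (auto simp: w_def)
    also have "\<dots> = (-1) ^ card j * (\<Prod>i\<in>j. inverse (k i))"
      by (simp only: prod.distrib prod_constant)
    also have "(\<Prod>i\<in>b. w i) = (\<Prod>i\<in>b. inverse (k i))"
      using jb(7) by (intro prod.cong) (auto simp: w_def)
    also have "(\<Prod>i\<in>b. inverse (k i)) * ((-1) ^ card j * (\<Prod>i\<in>j. inverse (k i))) = (-1) ^ card j * (\<Prod>i\<in>b \<union> j. inverse (k i :: 'f))"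
      using jb by (simp add: prod.union_disjoint)
    also have "(\<Prod>i\<in>b \<union> j. inverse (k i :: 'f)) = inverse (of_nat (valency U (b \<union> j)))"
      unfolding valency_def of_nat_prod by (induction rule: infinite_finite_induct) auto
    finally have w: "(-1) ^ card j * inverse (of_nat (valency U (b \<union> j))) = (\<Prod>i\<in>{1..n}. w i)"
      by (rule sym)
    show ?thesis
      unfolding jb(2,3) w B_mat_diag[OF jb(1) a(2)] tens_scale_all[symmetric]
      using j M(5) a(1) by (intro tens_cong) (auto simp: w_def cell_scale)
  qed
  have "D_mat n U x a b a = (\<Sum>j\<in>Pow S. tens n U (\<lambda>i. if i \<in> S then if i \<in> j then C i 0 0 0 0 (- inverse (k i)) else C i 0 0 0 1 0
      else if i \<in> b then C i 0 0 0 0 (inverse (k i)) else if i \<in> a then C i 0 0 0 1 0 else C i 1 0 0 0 (0 :: 'f)))"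
    unfolding D_mat_def index sum.reindex[OF inj] o_def by (intro sum.cong refl summand) auto
  also have "\<dots> = tens n U (\<lambda>i. if i \<in> S then C i 0 0 0 0 (- inverse (k i)) + C i 0 0 0 1 0
      else if i \<in> b then C i 0 0 0 0 (inverse (k i)) else if i \<in> a then C i 0 0 0 1 0 else C i 1 0 0 0 0)"
    using a by (intro tens_sum) auto
  also have "\<dots> = tens n U (\<lambda>i. if i \<in> S then C i 0 0 0 1 (- inverse (k i))
      else if i \<in> M then C i 0 0 0 0 (inverse (k i)) else if i \<in> a then C i 0 0 0 1 0 else C i 1 0 0 0 0)"
    by (rule tens_cong) (auto simp: cell_add b_def)
  finally show ?thesis
    by (simp only: b_def M_def)
qed

lemma D_sum_block_class:
  assumes S: "S \<subseteq> minus_part CHAR('f::field) U {1..n}"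
  shows "D_sum n U x (block_class CHAR('f) n U S) = (block S :: (nat \<Rightarrow> 'u, 'f) matrix)"
proof -
  let ?N = "minus_part CHAR('f) U {1..n}"
  define q where "q = {1..n} - S"
  have Sn: "S \<subseteq> {1..n}" using S by (auto simp: minus_part_def)
  have set: "{a. S \<subseteq> a \<and> a \<subseteq> {1..n}} = (\<lambda>a. S \<union> a) ` Pow q"
  proof (intro equalityI subsetI)
    fix a assume "a \<in> {a. S \<subseteq> a \<and> a \<subseteq> {1..n}}"
    then show "a \<in> (\<lambda>a. S \<union> a) ` Pow q"
      by (intro image_eqI[of _ _ "a - S"]) (auto simp: q_def)
  qed (use Sn in \<open>auto simp: q_def\<close>)
  have inj: "inj_on (\<lambda>a. S \<union> a) (Pow q)"
    unfolding q_def by (intro inj_onI) blast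
  have inj': "inj_on (\<lambda>a. (a, minus_part CHAR('f) U a - S, a)) A" for A
    by (auto simp: inj_on_def)
  have "D_sum n U x (block_class CHAR('f) n U S) =
    (\<Sum>a\<in>Pow q. D_mat n U x (S \<union> a) (minus_part CHAR('f) U (S \<union> a) - S) (S \<union> a) :: (nat \<Rightarrow> 'u, 'f) matrix)"
    unfolding D_sum_def block_class_def sum.reindex[OF inj'] set sum.reindex[OF inj] by (simp add: o_def)
  also have "\<dots> = (\<Sum>a\<in>Pow q. tens n U (\<lambda>i. if i \<in> q then if i \<in> a
      then (if i \<in> ?N then C i 0 0 0 0 (inverse (k i)) else C i 0 0 0 1 0) else C i 1 0 0 0 0
      else C i 0 0 0 1 (- inverse (k i))))"
  proof (rule sum.cong[OF refl])
    fix a assume a: "a \<in> Pow q"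
    then have a': "S \<union> a \<subseteq> {1..n}" using Sn by (auto simp: q_def)
    show "D_mat n U x (S \<union> a) (minus_part CHAR('f) U (S \<union> a) - S) (S \<union> a) =
      tens n U (\<lambda>i. if i \<in> q then if i \<in> a
      then (if i \<in> ?N then C i 0 0 0 0 (inverse (k i)) else C i 0 0 0 1 0) else C i 1 0 0 0 (0 :: 'f)
      else C i 0 0 0 1 (- inverse (k i)))"
      unfolding D_mat_diag[OF S Un_upper1 a'] unfolding minus_part_eq[OF a'] using a
      by (intro tens_cong) (auto simp: q_def)
  qed
  also have "\<dots> = tens n U (\<lambda>i. if i \<in> q
      then (if i \<in> ?N then C i 0 0 0 0 (inverse (k i)) else C i 0 0 0 1 0) + C i 1 0 0 0 0
      else C i 0 0 0 1 (- inverse (k i)))"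
    by (rule tens_sum) (simp add: q_def)
  also have "\<dots> = block S"
    unfolding block_def by (rule tens_cong) (auto simp: fac_def q_def cell_add)
  finally show ?thesis .
qed

end


section \<open>Transfer to an arbitrary enumeration of the classes\<close>

theorem theorem3p20:
  fixes n :: nat
    and U :: "nat \<Rightarrow> 'u set"
    and x :: "nat \<Rightarrow> 'u"
    and \<C> :: "nat \<Rightarrow> (nat set \<times> nat set \<times> nat set) set"
    and D :: "nat \<Rightarrow> (nat \<Rightarrow> 'u, 'f::field) matrix"
    and T :: "(nat \<Rightarrow> 'u, 'f) matrix set"
    and N :: nat
  assumes "n \<ge> 1"
    and "\<forall>a\<in>{1..n}. finite (U a) \<and> card (U a) \<ge> 2"
    and "x \<in> XX n U"
    and "N = 2 ^ n_minus CHAR('f) n U"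
    and "bij_betw \<C> {1..N} (diag_classes CHAR('f) n U)"
    and "\<forall>m\<in>{1..N}. D m = D_sum n U x (\<C> m)"
    and "T = terwilliger n U x"
  shows "inj_on D {1..N} \<and> D ` {1..N} = Bl (XX n U) T \<and> card (Bl (XX n U) T) = N \<and>
    inj_on (\<lambda>g. block_algebra (XX n U) T (D g)) {1..N} \<and>
    (\<lambda>g. block_algebra (XX n U) T (D g)) ` {1..N} = block_algebra (XX n U) T ` Bl (XX n U) T \<and>
    algebra_direct_sum (XX n U) T {1..N} (\<lambda>g. block_algebra (XX n U) T (D g))"
proof -
  interpret factorial_scheme n U x
    using assms(2,3) by unfold_locales auto
  let ?N = "minus_part CHAR('f) U {1..n}" and ?cls = "block_class CHAR('f) n U"
  \<comment> \<open>\<open>S m\<close> is the subset of \<open>minus_part\<close> that labels the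
    class \<open>\<C> m\<close>, so the given enumeration becomes one of the matrices
    \<open>block\<close>.\<close>
  define S where "S = the_inv_into (Pow ?N) ?cls \<circ> \<C>"
  have cls: "bij_betw ?cls (Pow ?N) (diag_classes CHAR('f) n U)"
    by (rule bij_betw_block_class)
  have S: "bij_betw S {1..N} (Pow ?N)"
    unfolding S_def using assms(5) bij_betw_the_inv_into[OF cls] by (rule bij_betw_trans)
  have SN: "S m \<subseteq> ?N" if "m \<in> {1..N}" for m
    using bij_betw_apply[OF S that] by simp
  have D: "D m = block (S m)" if m: "m \<in> {1..N}" for m
  proof -
    have "?cls (S m) = \<C> m"
      unfolding S_def o_def using cls bij_betw_apply[OF assms(5) m] by (rule f_the_inv_into_f_bij_betw)
    then show ?thesis
      using assms(6) m D_sum_block_class[OF SN[OF m]] by metis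
  qed
  interpret central_decomposition "XX n U" T "{1..N}" D
  proof
    show "finite (XX n U)" by (rule finite_X)
    show "mat_subalgebra (XX n U) T" unfolding assms(7) by (rule T_subalgebra)
    show "finite {1..N}" by simp
    show "(\<Sum>g\<in>{1..N}. D g) = mat_one (XX n U)"
    proof -
      have "(\<Sum>g\<in>{1..N}. D g) = (\<Sum>g\<in>{1..N}. block (S g))"
        by (rule sum.cong) (simp_all only: D)
      also have "\<dots> = (\<Sum>K\<in>Pow ?N. block K)"
        by (rule sum.reindex_bij_betw[OF S])
      finally show ?thesis by (simp only: block_total)
    qed
  next
    fix g assume g: "g \<in> {1..N}"
    show "D g \<in> alg_center (XX n U) T" "D g \<noteq> 0" "mat_mult (XX n U) (D g) (D g) = D g"
      unfolding D[OF g] assms(7)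
      by (rule block_central[OF SN[OF g]], rule block_nonzero[OF SN[OF g]], rule block_idem[OF SN[OF g]])
    show "f = 0 \<or> f = D g" if "f \<in> alg_center (XX n U) T" "mat_mult (XX n U) f f = f"
      "mat_mult (XX n U) f (D g) = f" for f
      using block_indecomposable[OF SN[OF g]] that unfolding D[OF g] assms(7) by blast
    fix h assume h: "h \<in> {1..N}" "g \<noteq> h"
    have "S g \<noteq> S h"
      using inj_on_eq_iff[OF bij_betw_imp_inj_on[OF S] g h(1)] h(2) by simp
    then show "mat_mult (XX n U) (D g) (D h) = 0"
      unfolding D[OF g] D[OF h(1)] by (rule block_orth[OF SN[OF g] SN[OF h(1)]])
  qed
  have "card (Bl (XX n U) T) = N"
    unfolding Bl_eq using card_image[OF inj] by simp
  moreover have "(\<lambda>g. block_algebra (XX n U) T (D g)) ` {1..N} = block_algebra (XX n U) T ` Bl (XX n U) T"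
    unfolding Bl_eq by (simp only: image_image)
  ultimately show ?thesis
    using inj Bl_eq inj_block_algebra direct_sum by simp
qed

end
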